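(* There is a universal, sufficiently large constant $C>0$ such that the following holds. Let $n\ge4$, $\alpha\in(0,1)$, $\beta\in(0,1-\alpha)$, let $g_Y(y_1,y_2)$ and $g_Z(z_1,z_2)$ be real-valued bivariate functions symmetric in their arguments, and let $\mathcal{P}_1$ be a class of joint distributions $P=P_{YZ}$. If for all $P\in\mathcal{P}_1$ $$\mathbb{E}_P[U_n]\ \ge\ C\sqrt{\max\left\{\frac{\psi_1'(P)}{\beta n},\ \frac{\psi_2'(P)}{\alpha\beta n^2}\right\}},$$ then the type II error of the permutation test based on $U_n$ over $\mathcal{P}_1$ is uniformly bounded by $\beta$: $$\sup_{P\in\mathcal{P}_1}\mathbb{P}_P(U_n\le c_{1-\alpha,n})\le\beta .$$
   Context: Data: $X_i=(Y_i,Z_i)$, $i=1,\dots,n$, i.i.d. from $P=P_{YZ}$. Kernel: for $x_i=(y_i,z_i)$, $$h_{\rm in}(x_1,x_2,x_3,x_4):=\{g_Y(y_1,y_2)+g_Y(y_3,y_4)-g_Y(y_1,y_3)-g_Y(y_2,y_4)\}\cdot\{g_Z(z_1,z_2)+g_Z(z_3,z_4)-g_Z(z_1,z_3)-g_Z(z_2,z_4)\}.$$ $$U_n:=\frac{1}{n(n-1)(n-2)(n-3)}\sum h_{\rm in}(X_{i_1},X_{i_2},X_{i_3},X_{i_4}),$$ sum over all ordered 4-tuples of distinct indices in $\{1,\dots,n\}$. The symmetrized kernel $\overline h_{\rm in}(x_1,\dots,x_4)$ is the average of $h_{\rm in}(x_{\sigma(1)},\dots,x_{\sigma(4)})$ over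 the $4!$ permutations $\sigma$ of $\{1,2,3,4\}$. Define $\psi_1'(P):=\mathrm{Var}_P[\mathbb{E}_P\{\overline h_{\rm in}(X_1,X_2,X_3,X_4)\mid X_1\}]$ and $\psi_2'(P):=\max\{\mathbb{E}_P[g_Y^2(Y_1,Y_2)g_Z^2(Z_1,Z_2)],\ \mathbb{E}_P[g_Y^2(Y_1,Y_2)g_Z^2(Z_1,Z_3)],\ \mathbb{E}_P[g_Y^2(Y_1,Y_2)g_Z^2(Z_3,Z_4)]\}$. Permutation critical value: for a permutation $\pi$ of $\{1,\dots,n\}$, $U_n^\pi$ is $U_n$ computed from $(Y_1,Z_{\pi_1}),\dots,(Y_n,Z_{\pi_n})$, and $c_{1-\alpha,n}:=\inf\{t:\frac1{n!}\sum_\pi\mathbb{1}(U_n^\pi\le t)\ge1-\alpha\}$; the test rejects when $U_n>c_{1-\alpha,n}$.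
   Formalization: Adds ψ2'(P)>0 for P in the class: if ψ2'=0 (e.g. g_Y=0) the condition reads 0≥0 but the test never rejects, so the claim fails. C is stated for fixed sets of Y- and Z-values; one C for all follows by mapping the data to the reals (countably generated σ-algebras). *)

theory Defs
  imports "HOL-Probability.Probability" "HOL-Combinatorics.Combinatorics"
begin

text \<open>An observation is a pair \<open>(y, z)\<close> and a data set is a function from indices to observations,
  of which only the values at \<open>1, \<dots>, n\<close> matter.\<close>

definition h_in ::
  "('y \<Rightarrow> 'y \<Rightarrow> real) \<Rightarrow> ('z \<Rightarrow> 'z \<Rightarrow> real) \<Rightarrow>
   'y \<times> 'z \<Rightarrow> 'y \<times> 'z \<Rightarrow> 'y \<times> 'z \<Rightarrow> 'y \<times> 'z \<Rightarrow> real" where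
  "h_in gY gZ x1 x2 x3 x4 =
     (gY (fst x1) (fst x2) + gY (fst x3) (fst x4) - gY (fst x1) (fst x3) - gY (fst x2) (fst x4)) *
     (gZ (snd x1) (snd x2) + gZ (snd x3) (snd x4) - gZ (snd x1) (snd x3) - gZ (snd x2) (snd x4))"

definition U_stat ::
  "('y \<Rightarrow> 'y \<Rightarrow> real) \<Rightarrow> ('z \<Rightarrow> 'z \<Rightarrow> real) \<Rightarrow> nat \<Rightarrow> (nat \<Rightarrow> 'y \<times> 'z) \<Rightarrow> real" where
  "U_stat gY gZ n x =
     1 / (real n * (real n - 1) * (real n - 2) * (real n - 3)) *
     (\<Sum>(i1, i2, i3, i4) \<in> {(i1, i2, i3, i4).
         distinct [i1, i2, i3, i4] \<and> {i1, i2, i3, i4} \<subseteq> {1..n}}.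
       h_in gY gZ (x i1) (x i2) (x i3) (x i4))"

definition h_in_sym ::
  "('y \<Rightarrow> 'y \<Rightarrow> real) \<Rightarrow> ('z \<Rightarrow> 'z \<Rightarrow> real) \<Rightarrow> (nat \<Rightarrow> 'y \<times> 'z) \<Rightarrow> real" where
  "h_in_sym gY gZ x =
     1 / fact 4 * (\<Sum>\<sigma> | \<sigma> permutes {1..4}. h_in gY gZ (x (\<sigma> 1)) (x (\<sigma> 2)) (x (\<sigma> 3)) (x (\<sigma> 4)))"

text \<open>The law of \<open>(X\<^sub>1, \<dots>, X\<^sub>n)\<close> for an i.i.d. sample from \<open>P\<close>; \<open>X\<^sub>i\<close> is the \<open>i\<close>-th coordinate.\<close>

definition iid :: "nat \<Rightarrow> 'a measure \<Rightarrow> (nat \<Rightarrow> 'a) measure" where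
  "iid n P = Pi\<^sub>M {1..n} (\<lambda>_. P)"

text \<open>The sub-\<open>\<sigma>\<close>-algebra in the conditional expectation is the one generated by \<open>X\<^sub>1\<close>.\<close>

definition psi1 ::
  "('y \<Rightarrow> 'y \<Rightarrow> real) \<Rightarrow> ('z \<Rightarrow> 'z \<Rightarrow> real) \<Rightarrow> ('y \<times> 'z) measure \<Rightarrow> real" where
  "psi1 gY gZ P = prob_space.variance (iid 4 P)
     (real_cond_exp (iid 4 P) (vimage_algebra (space (iid 4 P)) (\<lambda>x. x 1) P) (h_in_sym gY gZ))"

text \<open>The second moments are formed in \<open>[0, \<infinity>]\<close>, so that no integrability has to be presupposed.
  If this quantity is infinite, a lower bound on \<open>E[U\<^sub>n]\<close> by a multiple of its square root fails; if it
  is finite, the kernel is square integrable, so that \<open>E[U\<^sub>n]\<close> and \<open>psi1\<close> are genuine. If it is \<open>0\<close>,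
  then \<open>U\<^sub>n\<close> and all its permuted versions vanish almost surely and the test never rejects, so
  the power claim concerns only distributions for which it is positive.\<close>

definition psi2 ::
  "('y \<Rightarrow> 'y \<Rightarrow> real) \<Rightarrow> ('z \<Rightarrow> 'z \<Rightarrow> real) \<Rightarrow> ('y \<times> 'z) measure \<Rightarrow> ennreal" where
  "psi2 gY gZ P = Max {
     \<integral>\<^sup>+ x. ennreal ((gY (fst (x 1)) (fst (x 2)))\<^sup>2 * (gZ (snd (x 1)) (snd (x 2)))\<^sup>2) \<partial>iid 4 P,
     \<integral>\<^sup>+ x. ennreal ((gY (fst (x 1)) (fst (x 2)))\<^sup>2 * (gZ (snd (x 1)) (snd (x 3)))\<^sup>2) \<partial>iid 4 P,
     \<integral>\<^sup>+ x. ennreal ((gY (fst (x 1)) (fst (x 2)))\<^sup>2 * (gZ (snd (x 3)) (snd (x 4)))\<^sup>2) \<partial>iid 4 P}"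

definition U_perm ::
  "('y \<Rightarrow> 'y \<Rightarrow> real) \<Rightarrow> ('z \<Rightarrow> 'z \<Rightarrow> real) \<Rightarrow> nat \<Rightarrow> (nat \<Rightarrow> nat) \<Rightarrow> (nat \<Rightarrow> 'y \<times> 'z) \<Rightarrow> real" where
  "U_perm gY gZ n \<pi> x = U_stat gY gZ n (\<lambda>i. (fst (x i), snd (x (\<pi> i))))"

definition perm_crit ::
  "('y \<Rightarrow> 'y \<Rightarrow> real) \<Rightarrow> ('z \<Rightarrow> 'z \<Rightarrow> real) \<Rightarrow> nat \<Rightarrow> real \<Rightarrow> (nat \<Rightarrow> 'y \<times> 'z) \<Rightarrow> real" where
  "perm_crit gY gZ n \<alpha> x =
     Inf {t. 1 / fact n * (\<Sum>\<pi> | \<pi> permutes {1..n}. of_bool (U_perm gY gZ n \<pi> x \<le> t)) \<ge> 1 - \<alpha>}"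

end

(* The permutation critical value is at most t as soon as the average V of the squared permuted
   statistics is at most alpha t^2, so with t = E[U]/2 the type II error is bounded by Chebyshev's
   inequality for U and Markov's inequality for V. Both V and the variance of U are double sums over
   index tuples. Exchanging two Z-indices in opposite positions flips the sign of the kernel, so in V
   the pairs of tuples sharing at most one index cancel. In the variance of U, disjoint pairs are
   uncorrelated, and the symmetries of the kernel turn every pair sharing exactly one index into one
   whose covariance is psi1. The remaining pairs are a fraction of order n^(-2), each contributing a
   multiple of psi2. *)

theory Submission
  imports Defs
begin

section \<open>Index tuples\<close>

text \<open>The same sign flip has two effects. Permuting the Z-sample moves only one factor of the
  kernel, so the flip survives and pairs cancel. Relabelling a whole tuple moves both factors, so
  the flips cancel and any index may be brought to the front. For this reason the projection
  \<open>phi\<close> of the unsymmetrized kernel is also that of the symmetrized kernel in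
  \<open>psi1\<close>. The rates dictate how much must cancel. Markov's inequality for V at level
  \<alpha> t^2 costs a factor 1/\<alpha>, and the hypothesis offers 1/\<alpha> only next to
  psi2/n^2. Pairs sharing exactly one index would contribute at order 1/n, so in V they must vanish,
  not merely be few. Chebyshev's inequality for U costs no 1/\<alpha>, so there these pairs may stay
  and produce psi1/n. Constants: counting and moment bounds give Var U at most 171 psi1/n + 700000
  psi2/n^2 and E V at most 700000 psi2/n^2. With t = E[U]/2 both tails together are at most 5600684
  \<beta> m / E[U]^2, where m is the maximum in the hypothesis. The choice C = 4096 works because
  its square 16777216 exceeds 5600684.\<close>

definition tuples4 :: "nat \<Rightarrow> nat list set" where
  "tuples4 n = {xs. length xs = 4 \<and> distinct xs \<and> set xs \<subseteq> {1..n}}"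

lemma finite_tuples4 [simp]: "finite (tuples4 n)"
  by (rule finite_subset[OF _ finite_lists_length_eq[of "{1..n}" 4]]) (auto simp: tuples4_def)

lemma card_tuples4:
  assumes "4 \<le> n"
  shows "real (card (tuples4 n)) = real n * (real n - 1) * (real n - 2) * (real n - 3)"
proof -
  obtain m where n: "n = m + 4"
    using assms by (metis add.commute le_Suc_ex)
  have "card (tuples4 n) = \<Prod>{n - 4 + 1 .. n}"
    using card_lists_distinct_length_eq[of "{1..n}" 4] assms by (simp add: tuples4_def)
  also have "{n - 4 + 1 .. n} = {m+1, m+2, m+3, m+4}"
    unfolding n by auto
  also have "\<Prod>{m+1, m+2, m+3, m+4} = (m+1) * (m+2) * (m+3) * (m+4)"
    by (simp add: algebra_simps)
  finally show ?thesis
    by (simp add: n algebra_simps)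
qed

text \<open>The ratio of n(n-1)(n-2)(n-3) to n^4 increases with n, and at n = 4 it is 24/256 = 3/32.
  Substituting n = m + 4 leaves a polynomial in m with nonnegative coefficients.\<close>

lemma card_tuples4_ge:
  assumes "4 \<le> n"
  shows "3 / 32 * real n ^ 4 \<le> real (card (tuples4 n))"
proof -
  obtain m where n: "n = m + 4"
    using assms by (metis add.commute le_Suc_ex)
  have "real (card (tuples4 n)) - 3 / 32 * real n ^ 4
        = 29 / 32 * real m ^ 4 + 17 / 2 * real m ^ 3 + 26 * real m ^ 2 + 26 * real m"
    by (subst card_tuples4[OF assms])
      (simp add: n field_simps power4_eq_xxxx power3_eq_cube power2_eq_square)
  also have "\<dots> \<ge> 0" by simp
  finally show ?thesis by simp
qed

lemma length4_nth: "length xs = 4 \<Longrightarrow> xs = [xs!0, xs!1, xs!2, xs!3]"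
  by (auto simp: numeral_eq_Suc length_Suc_conv)

lemma tuples4_nth:
  assumes "xs \<in> tuples4 n" "i < 4"
  shows "xs ! i \<in> {1..n}"
proof -
  have "xs ! i \<in> set xs" "set xs \<subseteq> {1..n}"
    using assms by (auto simp: tuples4_def)
  then show ?thesis by blast
qed

text \<open>Passes from the nested tuples of \<open>U_stat\<close> to lists. For lists the overlap
  of two tuples is \<open>set xs \<inter> set ys\<close>, and a list can serve as a reindexing of
  sample coordinates.\<close>

lemma bij_betw_tuples4:
  "bij_betw (\<lambda>xs. (xs!0, xs!1, xs!2, xs!3)) (tuples4 n)
     {(i1, i2, i3, i4). distinct [i1, i2, i3, i4] \<and> {i1, i2, i3, i4} \<subseteq> {1..n}}"
proof (rule bij_betwI[where g = "\<lambda>(i1, i2, i3, i4). [i1, i2, i3, i4]"], goal_cases)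
  case 1
  then show ?case
    by (auto simp: tuples4_def numeral_eq_Suc length_Suc_conv)
next
  case 2
  then show ?case by (auto simp: tuples4_def)
next
  case (3 x)
  then show ?case using length4_nth[of x] by (auto simp: tuples4_def)
qed auto

text \<open>A box bound that ignores distinctness; this costs only constants in the counts
  below.\<close>

lemma card_lists4_le:
  fixes A :: "nat \<Rightarrow> nat set"
  assumes "\<And>i. i < 4 \<Longrightarrow> finite (A i)"
  shows "finite {xs. length xs = 4 \<and> (\<forall>i<4. xs ! i \<in> A i)}"
    and "card {xs. length xs = 4 \<and> (\<forall>i<4. xs ! i \<in> A i)}
      \<le> card (A 0) * card (A 1) * card (A 2) * card (A 3)"
proof -
  let ?L = "{xs. length xs = 4 \<and> (\<forall>i<4. xs ! i \<in> A i)}"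
  let ?P = "A 0 \<times> A 1 \<times> A 2 \<times> A 3"
  have fin: "finite ?P" using assms by auto
  have sub: "?L \<subseteq> (\<lambda>(a, b, c, d). [a, b, c, d]) ` ?P"
  proof
    fix xs assume "xs \<in> ?L"
    then show "xs \<in> (\<lambda>(a, b, c, d). [a, b, c, d]) ` ?P"
      using length4_nth[of xs] by (intro image_eqI[where x = "(xs!0, xs!1, xs!2, xs!3)"]) auto
  qed
  show "finite ?L" using finite_subset[OF sub] fin by blast
  have "card ?L \<le> card ((\<lambda>(a, b, c, d). [a, b, c, d]) ` ?P)"
    by (rule card_mono[OF finite_imageI[OF fin] sub])
  also have "\<dots> \<le> card ?P" by (rule card_image_le[OF fin])
  finally show "card ?L \<le> card (A 0) * card (A 1) * card (A 2) * card (A 3)"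
    by (simp add: card_cartesian_product mult.assoc)
qed

lemma less4_cases: "(b::nat) < 4 \<Longrightarrow> b = 0 \<or> b = 1 \<or> b = 2 \<or> b = 3"
  by auto

lemma card_tuples4_fix1:
  assumes "b < 4"
  shows "card {ys \<in> tuples4 n. ys ! b = u} \<le> n ^ 3"
proof -
  let ?A = "\<lambda>i. if i = b then {u} else {1..n}"
  have "card {ys \<in> tuples4 n. ys ! b = u} \<le> card {xs. length xs = 4 \<and> (\<forall>i<4. xs ! i \<in> ?A i)}"
    by (rule card_mono[OF card_lists4_le(1)]) (use tuples4_nth in \<open>auto simp: tuples4_def\<close>)
  also have "\<dots> \<le> card (?A 0) * card (?A 1) * card (?A 2) * card (?A 3)"
    by (rule card_lists4_le(2)) auto
  also have "\<dots> = n ^ 3"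
    using less4_cases[OF assms] by (auto simp: power3_eq_cube)
  finally show ?thesis .
qed

lemma card_tuples4_fix2:
  assumes "b < 4" "c < 4" "b \<noteq> c"
  shows "card {ys \<in> tuples4 n. ys ! b = u \<and> ys ! c = v} \<le> n ^ 2"
proof -
  let ?A = "\<lambda>i. if i = b then {u} else if i = c then {v} else {1..n}"
  have "card {ys \<in> tuples4 n. ys ! b = u \<and> ys ! c = v}
      \<le> card {xs. length xs = 4 \<and> (\<forall>i<4. xs ! i \<in> ?A i)}"
    by (rule card_mono[OF card_lists4_le(1)]) (use tuples4_nth in \<open>auto simp: tuples4_def\<close>)
  also have "\<dots> \<le> card (?A 0) * card (?A 1) * card (?A 2) * card (?A 3)"
    by (rule card_lists4_le(2)) auto
  also have "\<dots> = n ^ 2"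
    using less4_cases[OF assms(1)] less4_cases[OF assms(2)] assms(3) by (auto simp: power2_eq_square)
  finally show ?thesis .
qed

text \<open>Union bound over the 4 possible shared values and the 4 positions in \<open>ys\<close>
  that can hold one.\<close>

lemma card_overlap_ge1:
  assumes "length xs = 4"
  shows "card {ys \<in> tuples4 n. 1 \<le> card (set xs \<inter> set ys)} \<le> 16 * n ^ 3"
proof -
  let ?I = "set xs \<times> {..<4::nat}"
  let ?T = "\<lambda>(u, b). {ys \<in> tuples4 n. ys ! b = u}"
  have "{ys \<in> tuples4 n. 1 \<le> card (set xs \<inter> set ys)} \<subseteq> (\<Union>p\<in>?I. ?T p)"
  proof
    fix ys assume ys: "ys \<in> {ys \<in> tuples4 n. 1 \<le> card (set xs \<inter> set ys)}"
    then have "set xs \<inter> set ys \<noteq> {}" by auto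
    then obtain u where "u \<in> set xs" "u \<in> set ys" by auto
    then show "ys \<in> (\<Union>p\<in>?I. ?T p)"
      using ys by (fastforce simp: in_set_conv_nth tuples4_def)
  qed
  then have "card {ys \<in> tuples4 n. 1 \<le> card (set xs \<inter> set ys)} \<le> card (\<Union>p\<in>?I. ?T p)"
    by (intro card_mono) auto
  also have "\<dots> \<le> (\<Sum>p\<in>?I. card (?T p))"
    by (rule card_UN_le) auto
  also have "\<dots> \<le> (\<Sum>p\<in>?I. n ^ 3)"
    by (rule sum_mono) (use card_tuples4_fix1 in auto)
  also have "\<dots> = card (set xs) * 4 * n ^ 3"
    by (simp add: card_cartesian_product)
  also have "\<dots> \<le> 16 * n ^ 3"
    using card_length[of xs] assms by simp
  finally show ?thesis .
qed

text \<open>Union bound over two shared values and the two positions in \<open>ys\<close> that hold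
  them.\<close>

lemma card_overlap_ge2:
  assumes "length xs = 4"
  shows "card {ys \<in> tuples4 n. 2 \<le> card (set xs \<inter> set ys)} \<le> 256 * n ^ 2"
proof -
  let ?I = "(set xs \<times> set xs) \<times> {p \<in> {..<4::nat} \<times> {..<4::nat}. fst p \<noteq> snd p}"
  let ?T = "\<lambda>((u, v), (b, c)). {ys \<in> tuples4 n. ys ! b = u \<and> ys ! c = v}"
  have "{ys \<in> tuples4 n. 2 \<le> card (set xs \<inter> set ys)} \<subseteq> (\<Union>p\<in>?I. ?T p)"
  proof
    fix ys assume ys: "ys \<in> {ys \<in> tuples4 n. 2 \<le> card (set xs \<inter> set ys)}"
    then have "\<not> card (set xs \<inter> set ys) \<le> Suc 0" by auto
    then obtain u v where uv: "u \<in> set xs" "u \<in> set ys" "v \<in> set xs" "v \<in> set ys" "u \<noteq> v"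
      by (metis IntE card_le_Suc0_iff_eq finite_Int List.finite_set)
    obtain b c where "b < 4" "c < 4" "ys ! b = u" "ys ! c = v"
      using uv ys by (auto simp: in_set_conv_nth tuples4_def)
    then show "ys \<in> (\<Union>p\<in>?I. ?T p)"
      using ys uv by (intro UN_I[where a = "((u, v), (b, c))"]) auto
  qed
  then have "card {ys \<in> tuples4 n. 2 \<le> card (set xs \<inter> set ys)} \<le> card (\<Union>p\<in>?I. ?T p)"
    by (intro card_mono) auto
  also have "\<dots> \<le> (\<Sum>p\<in>?I. card (?T p))"
    by (rule card_UN_le) auto
  also have "\<dots> \<le> (\<Sum>p\<in>?I. n ^ 2)"
    by (rule sum_mono) (use card_tuples4_fix2 in auto)
  also have "\<dots> = card (set xs) * card (set xs)
      * card {p \<in> {..<4::nat} \<times> {..<4::nat}. fst p \<noteq> snd p} * n ^ 2"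
    by (simp add: card_cartesian_product)
  \<comment> \<open>The ordered pairs of distinct positions are counted generously by all 16 pairs,
    whence 4 * 4 * 16 = 256.\<close>
  also have "\<dots> \<le> 4 * 4 * card ({..<4::nat} \<times> {..<4::nat}) * n ^ 2"
    by (intro mult_mono card_mono) (use card_length[of xs] assms in auto)
  finally show ?thesis by (simp add: card_cartesian_product)
qed

section \<open>The kernel\<close>

text \<open>Alternating sum over the edges of the 4-cycle a, b, d, c. A reflection that exchanges
  opposite corners (a with d, or b with c) maps plus edges to minus edges; one that exchanges a with
  b and c with d preserves the signs.\<close>

definition quad :: "('a \<Rightarrow> 'a \<Rightarrow> real) \<Rightarrow> 'a \<Rightarrow> 'a \<Rightarrow> 'a \<Rightarrow> 'a \<Rightarrow> real" where
  "quad g a b c d = g a b + g c d - g a c - g b d"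

definition kern ::
  "('y \<Rightarrow> 'y \<Rightarrow> real) \<Rightarrow> ('z \<Rightarrow> 'z \<Rightarrow> real) \<Rightarrow> (nat \<Rightarrow> nat) \<Rightarrow> (nat \<Rightarrow> 'y \<times> 'z) \<Rightarrow> nat list \<Rightarrow> real" where
  "kern gY gZ \<pi> x xs =
     quad gY (fst (x (xs!0))) (fst (x (xs!1))) (fst (x (xs!2))) (fst (x (xs!3))) *
     quad gZ (snd (x (\<pi> (xs!0)))) (snd (x (\<pi> (xs!1)))) (snd (x (\<pi> (xs!2)))) (snd (x (\<pi> (xs!3))))"

lemma U_perm_eq:
  assumes "4 \<le> n"
  shows "U_perm gY gZ n \<pi> x = (\<Sum>xs\<in>tuples4 n. kern gY gZ \<pi> x xs) / card (tuples4 n)"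
  unfolding U_perm_def U_stat_def
  by (subst sum.reindex_bij_betw[OF bij_betw_tuples4, symmetric])
     (simp add: card_tuples4[OF assms] kern_def h_in_def quad_def)

lemma U_stat_eq_U_perm: "U_stat gY gZ n = U_perm gY gZ n id"
  by (simp add: U_perm_def fun_eq_iff)

text \<open>Symmetry of \<open>g\<close> is available only on a carrier \<open>S\<close>, later
  \<open>space MY\<close> or \<open>space MZ\<close>, which accounts for the membership
  premises.\<close>

lemma quad_swap_outer:
  assumes "\<And>u v. u \<in> S \<Longrightarrow> v \<in> S \<Longrightarrow> g u v = g v u" "a \<in> S" "b \<in> S" "c \<in> S" "d \<in> S"
  shows "quad g d b c a = - quad g a b c d"
  using assms(1)[of a b] assms(1)[of a c] assms(1)[of b d] assms(1)[of c d] assms(2-)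
  by (simp add: quad_def)

lemma quad_swap_inner: "quad g a c b d = - quad g a b c d"
  by (simp add: quad_def)

lemma quad_swap_pairs:
  assumes "\<And>u v. u \<in> S \<Longrightarrow> v \<in> S \<Longrightarrow> g u v = g v u" "a \<in> S" "b \<in> S" "c \<in> S" "d \<in> S"
  shows "quad g b a d c = quad g a b c d"
  using assms(1)[of a b] assms(1)[of a c] assms(1)[of b d] assms(1)[of c d] assms(2-)
  by (simp add: quad_def)

text \<open>Composing on the right exchanges \<open>p\<close> and \<open>q\<close> before
  \<open>\<pi>\<close> acts, so the Z-arguments at two opposite positions of \<open>xs\<close> trade
  places while the Y-factor is untouched.\<close>

lemma kern_comp_transpose:
  assumes sym: "\<And>u v. u \<in> S \<Longrightarrow> v \<in> S \<Longrightarrow> gZ u v = gZ v u"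
    and xs: "xs \<in> tuples4 n" and \<pi>: "\<pi> permutes {1..n}"
    and S: "\<And>i. i \<in> {1..n} \<Longrightarrow> snd (x i) \<in> S"
    and pq: "(p, q) = (xs!0, xs!3) \<or> (p, q) = (xs!1, xs!2)"
  shows "kern gY gZ (\<pi> \<circ> Transposition.transpose p q) x xs = - kern gY gZ \<pi> x xs"
proof -
  obtain a b c d where abcd: "xs = [a, b, c, d]"
    using length4_nth[of xs] xs by (auto simp: tuples4_def)
  have dist: "a \<noteq> b" "a \<noteq> c" "a \<noteq> d" "b \<noteq> c" "b \<noteq> d" "c \<noteq> d"
    and "a \<in> {1..n}" "b \<in> {1..n}" "c \<in> {1..n}" "d \<in> {1..n}"
    using xs by (auto simp: tuples4_def abcd)
  then have mem: "snd (x (\<pi> a)) \<in> S" "snd (x (\<pi> b)) \<in> S" "snd (x (\<pi> c)) \<in> S" "snd (x (\<pi> d)) \<in> S"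
    using S \<pi> by (metis permutes_in_image)+
  show ?thesis
    using pq
  proof
    assume "(p, q) = (xs!0, xs!3)"
    then have "p = a" "q = d" by (auto simp: abcd)
    then show ?thesis
      using dist quad_swap_outer[where g = gZ and S = S, OF sym mem]
      by (simp add: kern_def abcd Transposition.transpose_def)
  next
    assume "(p, q) = (xs!1, xs!2)"
    then have "p = b" "q = c" by (auto simp: abcd)
    then show ?thesis
      using dist
        quad_swap_inner[of gZ "snd (x (\<pi> a))" "snd (x (\<pi> c))" "snd (x (\<pi> b))" "snd (x (\<pi> d))"]
      by (simp add: kern_def abcd Transposition.transpose_def)
  qed
qed

text \<open>The cancellation holds for each fixed data set: a reindexing of the permutations turns
  the sum into its own negative.\<close>

lemma sum_permutes_kern_eq_0:
  assumes sym: "\<And>u v. u \<in> S \<Longrightarrow> v \<in> S \<Longrightarrow> gZ u v = gZ v u"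
    and xs: "xs \<in> tuples4 n" and ys: "ys \<in> tuples4 n"
    and S: "\<And>i. i \<in> {1..n} \<Longrightarrow> snd (x i) \<in> S"
    and overlap: "card (set xs \<inter> set ys) \<le> 1"
  shows "(\<Sum>\<pi> | \<pi> permutes {1..n}. kern gY gZ \<pi> x xs * kern gY gZ \<pi> x ys) = 0"
proof -
  have len: "length xs = 4" "length ys = 4" and "distinct xs"
    using xs ys by (auto simp: tuples4_def)
  have uniq: "\<And>u v. u \<in> set xs \<inter> set ys \<Longrightarrow> v \<in> set xs \<inter> set ys \<Longrightarrow> u = v"
    using overlap card_le_Suc0_iff_eq[of "set xs \<inter> set ys"] by auto
  have mem: "xs!0 \<in> set xs" "xs!1 \<in> set xs" "xs!2 \<in> set xs" "xs!3 \<in> set xs"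
    using len by auto
  have ne: "xs!0 \<noteq> xs!1" "xs!0 \<noteq> xs!2" "xs!3 \<noteq> xs!1" "xs!3 \<noteq> xs!2"
    using \<open>distinct xs\<close> len by (auto simp: nth_eq_iff_index_eq)
  \<comment> \<open>The two opposite pairs of \<open>xs\<close> are disjoint, so a single shared
    index meets at most one of them; the other pair avoids \<open>ys\<close>.\<close>
  obtain p q where pq: "(p, q) = (xs!0, xs!3) \<or> (p, q) = (xs!1, xs!2)"
    and disj: "p \<notin> set ys" "q \<notin> set ys"
    using uniq mem ne by (metis IntI)
  let ?t = "Transposition.transpose p q"
  let ?F = "\<lambda>\<pi>. kern gY gZ \<pi> x xs * kern gY gZ \<pi> x ys"
  have t: "?t permutes {1..n}"
    using pq tuples4_nth[OF xs] by (intro permutes_swap_id) auto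
  \<comment> \<open>Right composition with \<open>?t\<close> is a bijection on permutations. It
    negates the kernel at \<open>xs\<close> and, since \<open>?t\<close> fixes every index in
    \<open>ys\<close>, preserves the kernel at \<open>ys\<close>.\<close>
  have "sum ?F {\<pi>. \<pi> permutes {1..n}} = (\<Sum>\<pi> | \<pi> permutes {1..n}. ?F (\<pi> \<circ> ?t))"
    by (rule sum_permutations_compose_right[OF t])
  also have "\<dots> = (\<Sum>\<pi> | \<pi> permutes {1..n}. - ?F \<pi>)"
  proof (rule sum.cong[OF refl])
    fix \<pi> assume "\<pi> \<in> {\<pi>. \<pi> permutes {1..n}}"
    then have \<pi>: "\<pi> permutes {1..n}" by simp
    have "\<And>i. i < 4 \<Longrightarrow> ?t (ys ! i) = ys ! i"
      using disj len by (metis nth_mem transpose_apply_other)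
    then have "kern gY gZ (\<pi> \<circ> ?t) x ys = kern gY gZ \<pi> x ys"
      by (simp add: kern_def)
    then show "?F (\<pi> \<circ> ?t) = - ?F \<pi>"
      using kern_comp_transpose[OF sym xs \<pi> S pq, where gY = gY] by simp
  qed
  finally show ?thesis by (simp add: sum_negf)
qed

section \<open>Second moments of the kernel\<close>

text \<open>Serves to complete patterns of two or three indices to the four distinct indices that
  \<open>m2_le_distinct\<close> requires.\<close>

lemma fresh4: "4 \<le> n \<Longrightarrow> \<exists>d\<in>{1..n::nat}. d \<noteq> a \<and> d \<noteq> b \<and> d \<noteq> c"
proof -
  assume "4 \<le> n"
  have "\<exists>d\<in>{1..4::nat}. d \<noteq> a \<and> d \<noteq> b \<and> d \<noteq> c"
  proof -
    have "{1..4::nat} = {1, 2, 3, 4}" by auto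
    then show ?thesis by auto
  qed
  with \<open>4 \<le> n\<close> show ?thesis by fastforce
qed

lemma quad_sq_le:
  "(quad g a b c d)\<^sup>2 \<le> 4 * ((g a b)\<^sup>2 + (g c d)\<^sup>2 + (g a c)\<^sup>2 + (g b d)\<^sup>2)"
proof -
  have "(p + q - r - s)\<^sup>2 \<le> 4 * (p\<^sup>2 + q\<^sup>2 + r\<^sup>2 + s\<^sup>2)" for p q r s :: real
  proof -
    \<comment> \<open>Lagrange's identity for Cauchy-Schwarz against the sign vector (1, 1, -1, -1):
      the defect is a sum of squares over the six pairs of terms.\<close>
    have "4 * (p\<^sup>2 + q\<^sup>2 + r\<^sup>2 + s\<^sup>2) - (p + q - r - s)\<^sup>2
        = (p - q)\<^sup>2 + (p + r)\<^sup>2 + (p + s)\<^sup>2 + (q + r)\<^sup>2 + (q + s)\<^sup>2 + (r - s)\<^sup>2"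
      by (simp add: power2_eq_square algebra_simps)
    also have "\<dots> \<ge> 0" by simp
    finally show ?thesis by simp
  qed
  then show ?thesis unfolding quad_def by blast
qed

section \<open>The sampling model: spaces, measurability and relabelling\<close>

locale indep_test = prob_space P for P :: "('y \<times> 'z) measure" +
  fixes MY :: "'y measure" and MZ :: "'z measure"
    and gY :: "'y \<Rightarrow> 'y \<Rightarrow> real" and gZ :: "'z \<Rightarrow> 'z \<Rightarrow> real"
  assumes sets_P: "sets P = sets (MY \<Otimes>\<^sub>M MZ)"
    and gY_measurable: "case_prod gY \<in> borel_measurable (MY \<Otimes>\<^sub>M MY)"
    and gZ_measurable: "case_prod gZ \<in> borel_measurable (MZ \<Otimes>\<^sub>M MZ)"
    and gY_sym: "\<And>u v. u \<in> space MY \<Longrightarrow> v \<in> space MY \<Longrightarrow> gY u v = gY v u"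
    and gZ_sym: "\<And>u v. u \<in> space MZ \<Longrightarrow> v \<in> space MZ \<Longrightarrow> gZ u v = gZ v u"
    and psi2_finite: "psi2 gY gZ P < \<infinity>"
begin

text \<open>Keeps the index \<open>1\<close> literal: otherwise simp rewrites it to
  \<open>Suc 0\<close>, and index sets and coordinates such as \<open>x 1\<close> stop
  matching.\<close>

declare One_nat_def [simp del]

abbreviation sample :: "nat set \<Rightarrow> (nat \<Rightarrow> 'y \<times> 'z) measure" where
  "sample I \<equiv> Pi\<^sub>M I (\<lambda>_. P)"

abbreviation K :: "(nat \<Rightarrow> 'y \<times> 'z) \<Rightarrow> nat list \<Rightarrow> real" where
  "K \<equiv> kern gY gZ id"

definition second_moment :: real where
  "second_moment = enn2real (psi2 gY gZ P)"

lemma psi2_eq: "psi2 gY gZ P = ennreal second_moment"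
  using psi2_finite by (simp add: second_moment_def)

lemma second_moment_nonneg: "0 \<le> second_moment"
  by (simp add: second_moment_def)

lemma prob_space_sample: "prob_space (sample I)"
  by (intro prob_space_PiM prob_space_axioms)

lemma product_prob_space_P: "product_prob_space (\<lambda>_::nat. P)"
  by (rule product_prob_spaceI) (rule prob_space_axioms)

lemma space_P: "space P = space MY \<times> space MZ"
  using sets_eq_imp_space_eq[OF sets_P] by (simp add: space_pair_measure)

lemma sample_in_space:
  assumes "x \<in> space (sample I)" "i \<in> I"
  shows "x i \<in> space P" "fst (x i) \<in> space MY" "snd (x i) \<in> space MZ"
proof -
  show "x i \<in> space P" using assms by (auto simp: space_PiM)
  then show "fst (x i) \<in> space MY" "snd (x i) \<in> space MZ" by (auto simp: space_P)
qed

lemma measurable_fst_snd_P [measurable]: "fst \<in> P \<rightarrow>\<^sub>M MY" "snd \<in> P \<rightarrow>\<^sub>M MZ"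
  by (simp_all add: measurable_cong_sets[OF sets_P refl])

lemma measurable_gY [measurable (raw)]:
  assumes "f \<in> M \<rightarrow>\<^sub>M MY" "h \<in> M \<rightarrow>\<^sub>M MY"
  shows "(\<lambda>x. gY (f x) (h x)) \<in> borel_measurable M"
  using measurable_compose[OF measurable_Pair[OF assms] gY_measurable] by simp

lemma measurable_gZ [measurable (raw)]:
  assumes "f \<in> M \<rightarrow>\<^sub>M MZ" "h \<in> M \<rightarrow>\<^sub>M MZ"
  shows "(\<lambda>x. gZ (f x) (h x)) \<in> borel_measurable M"
  using measurable_compose[OF measurable_Pair[OF assms] gZ_measurable] by simp

lemma measurable_kern:
  assumes "\<And>i. i < 4 \<Longrightarrow> xs ! i \<in> I" "\<And>i. i < 4 \<Longrightarrow> \<pi> (xs ! i) \<in> I"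
  shows "(\<lambda>x. kern gY gZ \<pi> x xs) \<in> borel_measurable (sample I)"
proof -
  have [measurable]: "xs!0 \<in> I" "xs!1 \<in> I" "xs!2 \<in> I" "xs!3 \<in> I"
    "\<pi> (xs!0) \<in> I" "\<pi> (xs!1) \<in> I" "\<pi> (xs!2) \<in> I" "\<pi> (xs!3) \<in> I"
    using assms(1)[of 0] assms(1)[of 1] assms(1)[of 2] assms(1)[of 3]
      assms(2)[of 0] assms(2)[of 1] assms(2)[of 2] assms(2)[of 3] by simp_all
  show ?thesis
    unfolding kern_def quad_def by measurable
qed

text \<open>Relabelling principle behind all later reductions: an integral that involves only the
  coordinates in \<open>zs\<close> depends on their pattern of coincidences alone. Two index
  configurations with the same pattern are compared by moving both to
  \<open>{..<length zs}\<close>.\<close>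

lemma distr_sample_nth:
  assumes "distinct zs" "set zs \<subseteq> I"
  shows "distr (sample I) (sample {..<length zs}) (\<lambda>x. \<lambda>i\<in>{..<length zs}. x (zs ! i))
    = sample {..<length zs}"
  by (rule distr_PiM_reindex[where f = "\<lambda>i. zs ! i" and M = "\<lambda>_. P"])
     (use assms prob_space_axioms in \<open>auto simp: inj_on_def nth_eq_iff_index_eq subset_iff\<close>)

lemma measurable_sample_nth:
  assumes "set zs \<subseteq> I"
  shows "(\<lambda>x. \<lambda>i\<in>{..<length zs}. x (zs ! i)) \<in> sample I \<rightarrow>\<^sub>M sample {..<length zs}"
  by (rule measurable_restrict, rule measurable_component_singleton) (use assms in auto)

lemma nn_integral_sample_nth:
  assumes "distinct zs" "set zs \<subseteq> I" "F \<in> borel_measurable (sample {..<length zs})"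
  shows "(\<integral>\<^sup>+x. F (\<lambda>i\<in>{..<length zs}. x (zs ! i)) \<partial>sample I) = integral\<^sup>N (sample {..<length zs}) F"
  by (subst distr_sample_nth[OF assms(1,2), symmetric],
      subst nn_integral_distr[OF measurable_sample_nth[OF assms(2)]])
     (use assms(3) in auto)

lemma integral_sample_nth:
  fixes F :: "(nat \<Rightarrow> 'y \<times> 'z) \<Rightarrow> real"
  assumes "distinct zs" "set zs \<subseteq> I" "F \<in> borel_measurable (sample {..<length zs})"
  shows "(\<integral>x. F (\<lambda>i\<in>{..<length zs}. x (zs ! i)) \<partial>sample I) = integral\<^sup>L (sample {..<length zs}) F"
  by (subst distr_sample_nth[OF assms(1,2), symmetric],
      subst integral_distr[OF measurable_sample_nth[OF assms(2)]])
     (use assms(3) in auto)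

section \<open>Mixed second moments and their bound by psi2\<close>

definition m2 :: "nat set \<Rightarrow> nat \<Rightarrow> nat \<Rightarrow> nat \<Rightarrow> nat \<Rightarrow> ennreal" where
  "m2 I a b c d =
     (\<integral>\<^sup>+x. ennreal ((gY (fst (x a)) (fst (x b)))\<^sup>2 * (gZ (snd (x c)) (snd (x d)))\<^sup>2) \<partial>sample I)"

lemma m2_nth:
  assumes "distinct zs" "set zs \<subseteq> I"
    and [simp]: "p < length zs" "q < length zs" "r < length zs" "s < length zs"
  shows "m2 I (zs ! p) (zs ! q) (zs ! r) (zs ! s) = m2 {..<length zs} p q r s"
  unfolding m2_def
  by (subst nn_integral_sample_nth[OF assms(1,2), symmetric]) simp_all

lemma m2_swap_Y: "a \<in> I \<Longrightarrow> b \<in> I \<Longrightarrow> m2 I b a c d = m2 I a b c d"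
  unfolding m2_def by (rule nn_integral_cong) (simp add: sample_in_space gY_sym)

lemma m2_swap_Z: "c \<in> I \<Longrightarrow> d \<in> I \<Longrightarrow> m2 I a b d c = m2 I a b c d"
  unfolding m2_def by (rule nn_integral_cong) (simp add: sample_in_space gZ_sym)

lemma m2_le_distinct:
  assumes "distinct [a, b, c, d]" "{a, b, c, d} \<subseteq> I"
  shows "m2 I a b a b \<le> psi2 gY gZ P" "m2 I a b a c \<le> psi2 gY gZ P" "m2 I a b c d \<le> psi2 gY gZ P"
proof -
  have psi2: "psi2 gY gZ P = Max {m2 {1..4} 1 2 1 2, m2 {1..4} 1 2 1 3, m2 {1..4} 1 2 3 4}"
    by (simp add: psi2_def m2_def iid_def)
  have to4: "m2 I ([a,b,c,d] ! p) ([a,b,c,d] ! q) ([a,b,c,d] ! r) ([a,b,c,d] ! s)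
      = m2 {1..4} ([1,2,3,4] ! p) ([1,2,3,4] ! q) ([1,2,3,4] ! r) ([1,2,3,4] ! s)"
    if "p < 4" "q < 4" "r < 4" "s < 4" for p q r s
    using m2_nth[of "[a,b,c,d]" I p q r s] m2_nth[of "[1,2,3,4]" "{1..4}" p q r s] that assms
    by simp
  have 1: "m2 I a b a b = m2 {1..4} 1 2 1 2" using to4[of 0 1 0 1] by simp
  have 2: "m2 I a b a c = m2 {1..4} 1 2 1 3" using to4[of 0 1 0 2] by simp
  have 3: "m2 I a b c d = m2 {1..4} 1 2 3 4" using to4[of 0 1 2 3] by simp
  show "m2 I a b a b \<le> psi2 gY gZ P" "m2 I a b a c \<le> psi2 gY gZ P" "m2 I a b c d \<le> psi2 gY gZ P"
    unfolding 1 2 3 psi2 by (rule Max_ge; simp)+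
qed

text \<open>Up to the symmetries of \<open>gY\<close> and \<open>gZ\<close>, the pairs {a, b} and
  {c, d} share two, one or no index; these are the three moments whose maximum is
  \<open>psi2\<close>.\<close>

lemma m2_le:
  assumes n: "4 \<le> n" and I: "a \<in> {1..n}" "b \<in> {1..n}" "c \<in> {1..n}" "d \<in> {1..n}"
    and ne: "a \<noteq> b" "c \<noteq> d"
  shows "m2 {1..n} a b c d \<le> psi2 gY gZ P"
proof -
  have same: "m2 {1..n} a b a b \<le> psi2 gY gZ P"
  proof -
    obtain c' where c': "c' \<in> {1..n}" "c' \<noteq> a" "c' \<noteq> b"
      using fresh4[OF n] by blast
    obtain d' where d': "d' \<in> {1..n}" "d' \<noteq> a" "d' \<noteq> b" "d' \<noteq> c'"
      using fresh4[OF n] by blast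
    show ?thesis
      by (rule m2_le_distinct[of a b c' d']) (use c' d' I ne in auto)
  qed
  have share: "m2 {1..n} p q p r \<le> psi2 gY gZ P"
    if "p \<in> {1..n}" "q \<in> {1..n}" "r \<in> {1..n}" "p \<noteq> q" "p \<noteq> r" "q \<noteq> r" for p q r
  proof -
    obtain d' where d': "d' \<in> {1..n}" "d' \<noteq> p" "d' \<noteq> q" "d' \<noteq> r"
      using fresh4[OF n] by blast
    show ?thesis
      by (rule m2_le_distinct[of p q r d']) (use d' that in auto)
  qed
  consider "{c, d} = {a, b}" | "c = a" "d \<noteq> b" | "d = a" "c \<noteq> b" | "c = b" "d \<noteq> a"
    | "d = b" "c \<noteq> a" | "distinct [a, b, c, d]"
    using ne by auto
  then show ?thesis
  proof cases
    case 1
    then have "c = a \<and> d = b \<or> c = b \<and> d = a" by (auto simp: doubleton_eq_iff)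
    then show ?thesis using same m2_swap_Z[of a "{1..n}" b a b] I by auto
  next
    case 2
    then show ?thesis using share[of a b d] I ne by auto
  next
    case 3
    then show ?thesis using share[of a b c] m2_swap_Z[of a "{1..n}" c a b] I ne by auto
  next
    case 4
    then show ?thesis using share[of b a d] m2_swap_Y[of b "{1..n}" a b d] I ne by auto
  next
    case 5
    then show ?thesis using share[of b a c] m2_swap_Y[of b "{1..n}" a c b]
      m2_swap_Z[of b "{1..n}" c b a] I ne by auto
  next
    case 6
    then show ?thesis using m2_le_distinct(3)[of a b c d "{1..n}"] I by simp
  qed
qed

text \<open>A permutation may create any overlap between the Y-pair and the Z-pair, but by
  injectivity it keeps the two Z-indices distinct, so \<open>m2_le\<close> applies uniformly in
  \<open>\<pi>\<close>.\<close>

lemma nn_integral_kern_sq_le: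
  assumes n: "4 \<le> n" and xs: "xs \<in> tuples4 n" and \<pi>: "\<pi> permutes {1..n}"
  shows "(\<integral>\<^sup>+x. ennreal ((kern gY gZ \<pi> x xs)\<^sup>2) \<partial>sample {1..n}) \<le> ennreal (256 * second_moment)"
proof -
  \<comment> \<open>The position pairs of the four summands of \<open>quad\<close>.\<close>
  define Q :: "(nat \<times> nat) set" where "Q = {(0, 1), (2, 3), (0, 2), (1, 3)}"
  define A where "A = (\<lambda>p (x :: nat \<Rightarrow> 'y \<times> 'z). (gY (fst (x (xs ! fst p))) (fst (x (xs ! snd p))))\<^sup>2)"
  define B where "B = (\<lambda>p (x :: nat \<Rightarrow> 'y \<times> 'z). (gZ (snd (x (\<pi> (xs ! fst p)))) (snd (x (\<pi> (xs ! snd p)))))\<^sup>2)"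
  have Q: "finite Q" "card Q = 4" by (auto simp: Q_def)
  have Q4: "fst p < 4 \<and> snd p < 4 \<and> fst p \<noteq> snd p" if "p \<in> Q" for p
    using that by (auto simp: Q_def)
  have mem: "xs ! i \<in> {1..n}" "\<pi> (xs ! i) \<in> {1..n}" if "i < 4" for i
    using tuples4_nth[OF xs that] permutes_in_image[OF \<pi>] by auto
  have ne: "xs ! fst p \<noteq> xs ! snd p" "\<pi> (xs ! fst p) \<noteq> \<pi> (xs ! snd p)" if "p \<in> Q" for p
  proof -
    show "xs ! fst p \<noteq> xs ! snd p"
      using xs Q4[OF that] by (auto simp: tuples4_def nth_eq_iff_index_eq)
    then show "\<pi> (xs ! fst p) \<noteq> \<pi> (xs ! snd p)"
      using permutes_inj[OF \<pi>] by (simp add: inj_eq)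
  qed
  have AB: "(\<integral>\<^sup>+x. ennreal (A p x * B q x) \<partial>sample {1..n}) \<le> ennreal second_moment"
    if "p \<in> Q" "q \<in> Q" for p q
    using m2_le[of n "xs ! fst p" "xs ! snd p" "\<pi> (xs ! fst q)" "\<pi> (xs ! snd q)"]
      n mem Q4 ne that by (simp add: m2_def A_def B_def psi2_eq)
  have AB_meas [measurable]: "(\<lambda>x. ennreal (A p x * B q x)) \<in> borel_measurable (sample {1..n})"
    if "p \<in> Q" "q \<in> Q" for p q
  proof -
    have [measurable]: "xs ! fst p \<in> {1..n}" "xs ! snd p \<in> {1..n}"
      "\<pi> (xs ! fst q) \<in> {1..n}" "\<pi> (xs ! snd q) \<in> {1..n}"
      using mem Q4 that by auto
    show ?thesis unfolding A_def B_def by measurable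
  qed
  have "(kern gY gZ \<pi> x xs)\<^sup>2 \<le> 16 * (\<Sum>p\<in>Q. \<Sum>q\<in>Q. A p x * B q x)" for x
  proof -
    \<comment> \<open>Each squared factor costs 4, which gives 16; the 16 products of one Y-term and
      one Z-term raise this to 256.\<close>
    have "(kern gY gZ \<pi> x xs)\<^sup>2 \<le> (4 * (\<Sum>p\<in>Q. A p x)) * (4 * (\<Sum>q\<in>Q. B q x))"
      unfolding kern_def power_mult_distrib
      by (rule mult_mono; (rule order_trans[OF quad_sq_le])?)
         (simp_all add: A_def B_def Q_def)
    then show ?thesis by (simp add: sum_product)
  qed
  then have "(\<integral>\<^sup>+x. ennreal ((kern gY gZ \<pi> x xs)\<^sup>2) \<partial>sample {1..n})
      \<le> (\<integral>\<^sup>+x. ennreal (16 * (\<Sum>p\<in>Q. \<Sum>q\<in>Q. A p x * B q x)) \<partial>sample {1..n})"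
    by (intro nn_integral_mono ennreal_leI)
  also have "\<dots> = (\<integral>\<^sup>+x. 16 * (\<Sum>p\<in>Q. \<Sum>q\<in>Q. ennreal (A p x * B q x)) \<partial>sample {1..n})"
  proof (rule nn_integral_cong)
    fix x
    have nonneg: "0 \<le> A p x * B q x" for p q by (simp add: A_def B_def)
    then show "ennreal (16 * (\<Sum>p\<in>Q. \<Sum>q\<in>Q. A p x * B q x))
        = 16 * (\<Sum>p\<in>Q. \<Sum>q\<in>Q. ennreal (A p x * B q x))"
      by (subst ennreal_mult) (simp_all add: sum_ennreal sum_nonneg)
  qed
  also have "\<dots> = 16 * (\<Sum>p\<in>Q. \<Sum>q\<in>Q. \<integral>\<^sup>+x. ennreal (A p x * B q x) \<partial>sample {1..n})"
  proof -
    have "(\<integral>\<^sup>+x. (\<Sum>p\<in>Q. \<Sum>q\<in>Q. ennreal (A p x * B q x)) \<partial>sample {1..n})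
        = (\<Sum>p\<in>Q. \<integral>\<^sup>+x. (\<Sum>q\<in>Q. ennreal (A p x * B q x)) \<partial>sample {1..n})"
      by (intro nn_integral_sum borel_measurable_sum AB_meas)
    also have "\<dots> = (\<Sum>p\<in>Q. \<Sum>q\<in>Q. \<integral>\<^sup>+x. ennreal (A p x * B q x) \<partial>sample {1..n})"
      by (intro sum.cong[OF refl] nn_integral_sum AB_meas)
    finally show ?thesis
      by (subst nn_integral_cmult) (intro borel_measurable_sum AB_meas, assumption+, simp)
  qed
  also have "\<dots> \<le> 16 * (\<Sum>p\<in>Q. \<Sum>q\<in>Q. ennreal second_moment)"
    by (intro mult_left_mono sum_mono AB) auto
  also have "\<dots> = ennreal (256 * second_moment)"
    using second_moment_nonneg by (simp add: Q ennreal_mult mult.assoc[symmetric])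
  finally show ?thesis .
qed

lemma measurable_kern_tuples4:
  assumes "xs \<in> tuples4 n" "\<pi> permutes {1..n}"
  shows "(\<lambda>x. kern gY gZ \<pi> x xs) \<in> borel_measurable (sample {1..n})"
  by (rule measurable_kern) (use tuples4_nth[OF assms(1)] permutes_in_image[OF assms(2)] in auto)

lemma integrable_kern_sq:
  assumes "4 \<le> n" "xs \<in> tuples4 n" "\<pi> permutes {1..n}"
  shows "integrable (sample {1..n}) (\<lambda>x. (kern gY gZ \<pi> x xs)\<^sup>2)"
    and "(\<integral>x. (kern gY gZ \<pi> x xs)\<^sup>2 \<partial>sample {1..n}) \<le> 256 * second_moment"
proof -
  have [measurable]: "(\<lambda>x. kern gY gZ \<pi> x xs) \<in> borel_measurable (sample {1..n})"
    by (rule measurable_kern_tuples4[OF assms(2,3)])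
  show int: "integrable (sample {1..n}) (\<lambda>x. (kern gY gZ \<pi> x xs)\<^sup>2)"
  proof (rule integrableI_bounded)
    show "(\<integral>\<^sup>+x. ennreal (norm ((kern gY gZ \<pi> x xs)\<^sup>2)) \<partial>sample {1..n}) < \<infinity>"
      using le_less_trans[OF nn_integral_kern_sq_le[OF assms] ennreal_less_top] by simp
  qed measurable
  have "ennreal (\<integral>x. (kern gY gZ \<pi> x xs)\<^sup>2 \<partial>sample {1..n}) \<le> ennreal (256 * second_moment)"
    using nn_integral_kern_sq_le[OF assms] nn_integral_eq_integral[OF int] by simp
  then show "(\<integral>x. (kern gY gZ \<pi> x xs)\<^sup>2 \<partial>sample {1..n}) \<le> 256 * second_moment"
    using second_moment_nonneg by (subst (asm) ennreal_le_iff) auto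
qed

text \<open>A product is at most half the sum of the two squares, so the bound for a single square
  carries over without loss.\<close>

lemma integrable_kern_mult:
  assumes "4 \<le> n" "xs \<in> tuples4 n" "ys \<in> tuples4 n" "\<pi> permutes {1..n}"
  shows "integrable (sample {1..n}) (\<lambda>x. kern gY gZ \<pi> x xs * kern gY gZ \<pi> x ys)"
    and "(\<integral>x. kern gY gZ \<pi> x xs * kern gY gZ \<pi> x ys \<partial>sample {1..n}) \<le> 256 * second_moment"
proof -
  note xs = integrable_kern_sq[OF assms(1,2,4)] and ys = integrable_kern_sq[OF assms(1,3,4)]
  have [measurable]: "(\<lambda>x. kern gY gZ \<pi> x xs) \<in> borel_measurable (sample {1..n})"
    "(\<lambda>x. kern gY gZ \<pi> x ys) \<in> borel_measurable (sample {1..n})"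
    using assms by (auto intro: measurable_kern_tuples4)
  have young: "\<bar>a * b\<bar> \<le> (a\<^sup>2 + b\<^sup>2) / 2" for a b :: real
    using sum_squares_bound[of "\<bar>a\<bar>" "\<bar>b\<bar>"] by (simp add: abs_mult)
  show int: "integrable (sample {1..n}) (\<lambda>x. kern gY gZ \<pi> x xs * kern gY gZ \<pi> x ys)"
  proof (rule Bochner_Integration.integrable_bound)
    show "integrable (sample {1..n}) (\<lambda>x. ((kern gY gZ \<pi> x xs)\<^sup>2 + (kern gY gZ \<pi> x ys)\<^sup>2) / 2)"
      using xs(1) ys(1) by auto
  qed (measurable, use young in \<open>auto intro!: AE_I2\<close>)
  have "(\<integral>x. kern gY gZ \<pi> x xs * kern gY gZ \<pi> x ys \<partial>sample {1..n})
      \<le> (\<integral>x. ((kern gY gZ \<pi> x xs)\<^sup>2 + (kern gY gZ \<pi> x ys)\<^sup>2) / 2 \<partial>sample {1..n})"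
    proof (rule integral_mono[OF int])
    fix x
    show "kern gY gZ \<pi> x xs * kern gY gZ \<pi> x ys
        \<le> ((kern gY gZ \<pi> x xs)\<^sup>2 + (kern gY gZ \<pi> x ys)\<^sup>2) / 2"
      using young abs_le_D1 by blast
  qed (use xs(1) ys(1) in auto)
  also have "\<dots> \<le> 256 * second_moment"
    using xs ys by simp
  finally show "(\<integral>x. kern gY gZ \<pi> x xs * kern gY gZ \<pi> x ys \<partial>sample {1..n}) \<le> 256 * second_moment" .
qed

lemma integrable_kern:
  assumes "4 \<le> n" "xs \<in> tuples4 n" "\<pi> permutes {1..n}"
  shows "integrable (sample {1..n}) (\<lambda>x. kern gY gZ \<pi> x xs)"
proof -
  interpret S: prob_space "sample {1..n}" by (rule prob_space_sample)
  show ?thesis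
    by (rule S.square_integrable_imp_integrable[OF measurable_kern_tuples4[OF assms(2,3)]
          integrable_kern_sq(1)[OF assms]])
qed

section \<open>The second moment of the permuted statistics\<close>

text \<open>The second moment, about zero, of the permutation distribution for given data; this is
  V.\<close>

definition perm_moment :: "nat \<Rightarrow> (nat \<Rightarrow> 'y \<times> 'z) \<Rightarrow> real" where
  "perm_moment n x = (\<Sum>\<pi> | \<pi> permutes {1..n}. (U_perm gY gZ n \<pi> x)\<^sup>2) / fact n"

lemma U_perm_sq:
  assumes "4 \<le> n"
  shows "(U_perm gY gZ n \<pi> x)\<^sup>2 =
    (\<Sum>xs\<in>tuples4 n. \<Sum>ys\<in>tuples4 n. kern gY gZ \<pi> x xs * kern gY gZ \<pi> x ys) / (card (tuples4 n))\<^sup>2"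
  by (simp add: U_perm_eq[OF assms] power_divide power2_eq_square sum_product)

lemma integrable_U_perm_sq:
  assumes "4 \<le> n" "\<pi> permutes {1..n}"
  shows "integrable (sample {1..n}) (\<lambda>x. (U_perm gY gZ n \<pi> x)\<^sup>2)"
  unfolding U_perm_sq[OF assms(1)]
  by (intro Bochner_Integration.integrable_divide Bochner_Integration.integrable_sum
      integrable_kern_mult assms)

lemma integrable_perm_moment:
  assumes "4 \<le> n"
  shows "integrable (sample {1..n}) (perm_moment n)"
  unfolding perm_moment_def[abs_def]
  by (intro Bochner_Integration.integrable_divide Bochner_Integration.integrable_sum
      integrable_U_perm_sq assms) simp

lemma pos_card_tuples4:
  assumes "4 \<le> n"
  shows "0 < real (card (tuples4 n))"
proof -
  have "0 < 3 / 32 * real n ^ 4" using assms by simp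
  then show ?thesis using card_tuples4_ge[OF assms] by linarith
qed

lemma integral_perm_moment_le:
  assumes n: "4 \<le> n"
  shows "(\<integral>x. perm_moment n x \<partial>sample {1..n}) \<le> 700000 * second_moment / (real n)\<^sup>2"
proof -
  let ?S = "sample {1..n}" and ?Pm = "{\<pi>. \<pi> permutes {1..n}}"
  let ?N = "real (card (tuples4 n))"
  let ?J = "\<lambda>xs. {ys \<in> tuples4 n. 2 \<le> card (set xs \<inter> set ys)}"
  let ?F = "\<lambda>\<pi> xs ys x. kern gY gZ \<pi> x xs * kern gY gZ \<pi> x ys"
  have fin: "finite ?Pm" by (simp add: finite_permutations)
  \<comment> \<open>The sum over permutations is moved innermost before anything is integrated, so
    that the pointwise cancellation removes every pair of tuples with fewer than two common
    indices.\<close>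
  have eq: "perm_moment n x = (\<Sum>xs\<in>tuples4 n. \<Sum>ys\<in>?J xs. \<Sum>\<pi>\<in>?Pm. ?F \<pi> xs ys x) / (?N\<^sup>2 * fact n)"
    if x: "x \<in> space ?S" for x
  proof -
    have "(\<Sum>\<pi>\<in>?Pm. (U_perm gY gZ n \<pi> x)\<^sup>2)
        = (\<Sum>\<pi>\<in>?Pm. \<Sum>xs\<in>tuples4 n. \<Sum>ys\<in>tuples4 n. ?F \<pi> xs ys x) / ?N\<^sup>2"
      by (simp add: U_perm_sq[OF n] sum_divide_distrib)
    also have "(\<Sum>\<pi>\<in>?Pm. \<Sum>xs\<in>tuples4 n. \<Sum>ys\<in>tuples4 n. ?F \<pi> xs ys x)
        = (\<Sum>xs\<in>tuples4 n. \<Sum>\<pi>\<in>?Pm. \<Sum>ys\<in>tuples4 n. ?F \<pi> xs ys x)"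
      by (rule sum.swap)
    also have "\<dots> = (\<Sum>xs\<in>tuples4 n. \<Sum>ys\<in>tuples4 n. \<Sum>\<pi>\<in>?Pm. ?F \<pi> xs ys x)"
      by (rule sum.cong[OF refl], rule sum.swap)
    also have "\<dots> = (\<Sum>xs\<in>tuples4 n. \<Sum>ys\<in>?J xs. \<Sum>\<pi>\<in>?Pm. ?F \<pi> xs ys x)"
    proof (intro sum.cong[OF refl] sum.mono_neutral_right ballI)
      fix xs ys assume "xs \<in> tuples4 n" "ys \<in> tuples4 n - ?J xs"
      then show "(\<Sum>\<pi>\<in>?Pm. ?F \<pi> xs ys x) = 0"
        using sum_permutes_kern_eq_0[where S = "space MZ" and gZ = gZ and x = x, OF gZ_sym]
          sample_in_space(3)[OF x] by auto
    qed auto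
    finally show ?thesis by (simp add: perm_moment_def field_simps)
  qed
  have int: "integrable ?S (?F \<pi> xs ys)" "(\<integral>x. ?F \<pi> xs ys x \<partial>?S) \<le> 256 * second_moment"
    if "xs \<in> tuples4 n" "ys \<in> ?J xs" "\<pi> \<in> ?Pm" for \<pi> xs ys
    using integrable_kern_mult[OF n] that by auto
  have "(\<integral>x. perm_moment n x \<partial>?S)
      = (\<integral>x. (\<Sum>xs\<in>tuples4 n. \<Sum>ys\<in>?J xs. \<Sum>\<pi>\<in>?Pm. ?F \<pi> xs ys x) / (?N\<^sup>2 * fact n) \<partial>?S)"
    by (rule Bochner_Integration.integral_cong[OF refl eq])
  also have "\<dots> = (\<Sum>xs\<in>tuples4 n. \<Sum>ys\<in>?J xs. \<Sum>\<pi>\<in>?Pm. \<integral>x. ?F \<pi> xs ys x \<partial>?S) / (?N\<^sup>2 * fact n)"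
  proof -
    have "(\<integral>x. (\<Sum>xs\<in>tuples4 n. \<Sum>ys\<in>?J xs. \<Sum>\<pi>\<in>?Pm. ?F \<pi> xs ys x) \<partial>?S)
        = (\<Sum>xs\<in>tuples4 n. \<integral>x. (\<Sum>ys\<in>?J xs. \<Sum>\<pi>\<in>?Pm. ?F \<pi> xs ys x) \<partial>?S)"
      by (intro Bochner_Integration.integral_sum Bochner_Integration.integrable_sum int(1))
    also have "\<dots> = (\<Sum>xs\<in>tuples4 n. \<Sum>ys\<in>?J xs. \<integral>x. (\<Sum>\<pi>\<in>?Pm. ?F \<pi> xs ys x) \<partial>?S)"
      by (intro sum.cong[OF refl] Bochner_Integration.integral_sum
          Bochner_Integration.integrable_sum int(1))
    also have "\<dots> = (\<Sum>xs\<in>tuples4 n. \<Sum>ys\<in>?J xs. \<Sum>\<pi>\<in>?Pm. \<integral>x. ?F \<pi> xs ys x \<partial>?S)"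
      by (intro sum.cong[OF refl] Bochner_Integration.integral_sum int(1))
    finally show ?thesis by simp
  qed
  also have "\<dots> \<le> (\<Sum>xs\<in>tuples4 n. 256 * (real n)\<^sup>2 * (fact n * (256 * second_moment))) / (?N\<^sup>2 * fact n)"
  proof (intro divide_right_mono sum_mono)
    fix xs assume xs: "xs \<in> tuples4 n"
    have "(\<Sum>ys\<in>?J xs. \<Sum>\<pi>\<in>?Pm. \<integral>x. ?F \<pi> xs ys x \<partial>?S) \<le> (\<Sum>ys\<in>?J xs. \<Sum>\<pi>\<in>?Pm. 256 * second_moment)"
      by (intro sum_mono int(2)[OF xs])
    also have "\<dots> = card (?J xs) * (fact n * (256 * second_moment))"
      by (simp add: card_permutations[OF refl])
    also have "\<dots> \<le> 256 * (real n)\<^sup>2 * (fact n * (256 * second_moment))"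
    proof (rule mult_right_mono)
      have "card (?J xs) \<le> 256 * n ^ 2"
        using card_overlap_ge2 xs by (auto simp: tuples4_def)
      then have "real (card (?J xs)) \<le> real (256 * n ^ 2)" by (simp only: of_nat_le_iff)
      then show "real (card (?J xs)) \<le> 256 * (real n)\<^sup>2" by simp
    qed (simp add: second_moment_nonneg)
    finally show "(\<Sum>ys\<in>?J xs. \<Sum>\<pi>\<in>?Pm. \<integral>x. ?F \<pi> xs ys x \<partial>?S)
      \<le> 256 * (real n)\<^sup>2 * (fact n * (256 * second_moment))" .
  qed simp
  \<comment> \<open>65536 = 256 * 256 combines the count of overlapping tuples with the moment
    bound. The outer sum cancels one of the two factors \<open>?N\<close>, and 65536 * 32 / 3 is
    just below 700000.\<close>
  also have "\<dots> = 65536 * (real n)\<^sup>2 * second_moment / ?N"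
    using pos_card_tuples4[OF n] by (simp add: field_simps power2_eq_square)
  also have "\<dots> \<le> 65536 * (real n)\<^sup>2 * second_moment / (3 / 32 * real n ^ 4)"
    using card_tuples4_ge[OF n] pos_card_tuples4[OF n] n second_moment_nonneg
    by (intro divide_left_mono mult_pos_pos) auto
  also have "\<dots> = 65536 * 32 / 3 * (second_moment / (real n)\<^sup>2)"
    using n by (simp add: field_simps power4_eq_xxxx power2_eq_square)
  also have "\<dots> \<le> 700000 * (second_moment / (real n)\<^sup>2)"
    using second_moment_nonneg by (intro mult_right_mono) auto
  finally show ?thesis by simp
qed

section \<open>The projection of the kernel onto one observation\<close>

lemma measurable_h_in [measurable (raw)]:
  assumes "f1 \<in> M \<rightarrow>\<^sub>M P" "f2 \<in> M \<rightarrow>\<^sub>M P" "f3 \<in> M \<rightarrow>\<^sub>M P" "f4 \<in> M \<rightarrow>\<^sub>M P"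
  shows "(\<lambda>x. h_in gY gZ (f1 x) (f2 x) (f3 x) (f4 x)) \<in> borel_measurable M"
proof -
  note [measurable] = assms
  show ?thesis unfolding h_in_def by measurable
qed

lemma K_eq_h_in: "K x xs = h_in gY gZ (x (xs!0)) (x (xs!1)) (x (xs!2)) (x (xs!3))"
  by (simp add: kern_def quad_def h_in_def)

text \<open>First-order Hoeffding projection of the unsymmetrized kernel, not centred. That it
  represents the conditional expectation in \<open>psi1\<close> comes out in the proof of
  \<open>psi1_eq\<close>.\<close>

definition phi :: "'y \<times> 'z \<Rightarrow> real" where
  "phi u = (\<integral>y. h_in gY gZ u (y 1) (y 2) (y 3) \<partial>sample {1, 2, 3})"

lemma measurable_phi [measurable]: "phi \<in> borel_measurable P"
proof -
  interpret S: prob_space "sample {1, 2, 3}" by (rule prob_space_sample)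
  show ?thesis unfolding phi_def by measurable
qed

lemma phi_eq:
  assumes "u \<in> space P" "distinct [a, b, c]"
  shows "(\<integral>y. h_in gY gZ u (y a) (y b) (y c) \<partial>sample {a, b, c}) = phi u"
proof -
  let ?F = "\<lambda>y. h_in gY gZ u (y 0) (y 1) (y 2)"
  have F: "?F \<in> borel_measurable (sample {..<3})"
    using assms(1) by measurable
  have *: "(\<integral>y. h_in gY gZ u (y a) (y b) (y c) \<partial>sample {a, b, c}) = integral\<^sup>L (sample {..<3}) ?F"
    if "distinct [a, b, c]" for a b c
    using integral_sample_nth[of "[a,b,c]" "{a,b,c}" ?F] that F by (simp add: numeral_3_eq_3 One_nat_def)
  show ?thesis
    unfolding phi_def *[OF assms(2)] by (subst *) auto
qed

lemma integrable_integral_component: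
  fixes F :: "'y \<times> 'z \<Rightarrow> real"
  assumes "i \<in> I" and [measurable]: "F \<in> borel_measurable P"
  shows "integrable (sample I) (\<lambda>x. F (x i)) \<longleftrightarrow> integrable P F"
    and "(\<integral>x. F (x i) \<partial>sample I) = integral\<^sup>L P F"
proof -
  have d: "distr (sample I) P (\<lambda>x. x i) = P"
    by (rule distr_PiM_component[OF _ assms(1)]) (rule prob_space_axioms)
  have m: "(\<lambda>x. x i) \<in> sample I \<rightarrow>\<^sub>M P"
    using assms(1) by measurable
  show "integrable (sample I) (\<lambda>x. F (x i)) \<longleftrightarrow> integrable P F"
    using integrable_distr_eq[OF m assms(2)] d by simp
  show "(\<integral>x. F (x i) \<partial>sample I) = integral\<^sup>L P F"
    using integral_distr[OF m assms(2)] d by simp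
qed

text \<open>Fubini's theorem: \<open>a\<close>, \<open>b\<close>, \<open>c\<close> occur only in the
  kernel, so integrating them out leaves \<open>phi\<close> at coordinate \<open>i\<close>. Writing
  the weight with \<open>restrict\<close> makes it visibly a function of the block \<open>I\<close>.
  The integrability conclusion allows a second fold on the result.\<close>

lemma fold_phi:
  assumes "finite I" "i \<in> I" "distinct [a, b, c]" "{a, b, c} \<inter> I = {}"
    and W [measurable]: "W \<in> borel_measurable (sample I)"
    and int: "integrable (sample (I \<union> {a, b, c}))
      (\<lambda>x. W (restrict x I) * h_in gY gZ (x i) (x a) (x b) (x c))"
  shows "integrable (sample I) (\<lambda>x. W x * phi (x i))"
    and "(\<integral>x. W (restrict x I) * h_in gY gZ (x i) (x a) (x b) (x c) \<partial>sample (I \<union> {a, b, c}))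
      = (\<integral>x. W x * phi (x i) \<partial>sample I)"
proof -
  let ?J = "{a, b, c}"
  let ?f = "\<lambda>x. W (restrict x I) * h_in gY gZ (x i) (x a) (x b) (x c)"
  let ?g = "\<lambda>z. ?f (merge I ?J z)"
  interpret PP: product_prob_space "\<lambda>_::nat. P" UNIV by (rule product_prob_space_P)
  interpret I: prob_space "sample I" by (rule prob_space_sample)
  interpret J: prob_space "sample ?J" by (rule prob_space_sample)
  interpret IJ: pair_sigma_finite "sample I" "sample ?J" ..
  have disj: "I \<inter> ?J = {}" using assms(4) by blast
  have d: "distr (sample I \<Otimes>\<^sub>M sample ?J) (sample (I \<union> ?J)) (merge I ?J) = sample (I \<union> ?J)"
    by (rule PP.distr_merge[OF disj assms(1)]) simp
  have f [measurable]: "?f \<in> borel_measurable (sample (I \<union> ?J))"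
    using int by (rule borel_measurable_integrable)
  have g: "integrable (sample I \<Otimes>\<^sub>M sample ?J) ?g"
    by (rule integrable_distr[OF measurable_merge]) (simp only: d int)
  have inner: "(\<integral>y. ?g (x, y) \<partial>sample ?J) = W x * phi (x i)" if x: "x \<in> space (sample I)" for x
  proof -
    have "restrict (merge I ?J (x, y)) I = x" for y
      using x by (auto simp: fun_eq_iff merge_def space_PiM PiE_def extensional_def)
    moreover have "a \<notin> I" "b \<notin> I" "c \<notin> I" using assms(4) by auto
    ultimately have "?g (x, y) = W x * h_in gY gZ (x i) (y a) (y b) (y c)" for y
      using assms(2) by (simp add: merge_def)
    then show ?thesis
      using phi_eq[OF sample_in_space(1)[OF x assms(2)] assms(3)] by simp
  qed
  have "integrable (sample I) (\<lambda>x. \<integral>y. ?g (x, y) \<partial>sample ?J)"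
    by (rule IJ.integrable_fst'[OF g])
  then show "integrable (sample I) (\<lambda>x. W x * phi (x i))"
    by (rule Bochner_Integration.integrable_cong[THEN iffD1, rotated -1]) (use inner in auto)
  have "integral\<^sup>L (sample (I \<union> ?J)) ?f = integral\<^sup>L (sample I \<Otimes>\<^sub>M sample ?J) ?g"
    using integral_distr[OF measurable_merge f] d by simp
  also have "\<dots> = (\<integral>x. \<integral>y. ?g (x, y) \<partial>sample ?J \<partial>sample I)"
    by (rule IJ.integral_fst'[OF g, symmetric])
  also have "\<dots> = (\<integral>x. W x * phi (x i) \<partial>sample I)"
    by (rule Bochner_Integration.integral_cong) (use inner in auto)
  finally show "integral\<^sup>L (sample (I \<union> ?J)) ?f = (\<integral>x. W x * phi (x i) \<partial>sample I)" .
qed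

text \<open>The symmetries of the 4-cycle preserve both \<open>quad\<close> factors or negate both,
  hence fix their product, and three of them carry the last, second and third position to the front.
  Equality is claimed on the sample space only, where \<open>gY\<close> and \<open>gZ\<close> are
  symmetric.\<close>

lemma kern_front:
  assumes xs: "xs \<in> tuples4 n" and u: "u \<in> set xs"
  obtains b c d where "[u, b, c, d] \<in> tuples4 n" "{u, b, c, d} = set xs"
    "\<forall>x\<in>space (sample {1..n}). K x xs = K x [u, b, c, d]"
proof -
  obtain p q r s where pqrs: "xs = [p, q, r, s]"
    using length4_nth[of xs] xs by (auto simp: tuples4_def)
  have mem: "p \<in> {1..n}" "q \<in> {1..n}" "r \<in> {1..n}" "s \<in> {1..n}"
    and dist: "distinct [p, q, r, s]"
    using xs by (auto simp: tuples4_def pqrs)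
  have swaps: "K x [s, q, r, p] = K x [p, q, r, s]" "K x [q, p, s, r] = K x [p, q, r, s]"
    "K x [r, s, p, q] = K x [p, q, r, s]"
    if x: "x \<in> space (sample {1..n})" for x
  proof -
    note Y = sample_in_space(2)[OF x mem(1)] sample_in_space(2)[OF x mem(2)]
      sample_in_space(2)[OF x mem(3)] sample_in_space(2)[OF x mem(4)]
    note Z = sample_in_space(3)[OF x mem(1)] sample_in_space(3)[OF x mem(2)]
      sample_in_space(3)[OF x mem(3)] sample_in_space(3)[OF x mem(4)]
    show "K x [s, q, r, p] = K x [p, q, r, s]"
      using quad_swap_outer[where g = gY, OF gY_sym Y] quad_swap_outer[where g = gZ, OF gZ_sym Z]
      by (simp add: kern_def)
    show "K x [q, p, s, r] = K x [p, q, r, s]"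
      using quad_swap_pairs[where g = gY, OF gY_sym Y] quad_swap_pairs[where g = gZ, OF gZ_sym Z]
      by (simp add: kern_def)
    show "K x [r, s, p, q] = K x [p, q, r, s]"
      using gY_sym[OF Y(1,3)] gY_sym[OF Y(2,4)] gZ_sym[OF Z(1,3)] gZ_sym[OF Z(2,4)]
      by (simp add: kern_def quad_def algebra_simps)
  qed
  consider "u = p" | "u = q" | "u = r" | "u = s"
    using u by (auto simp: pqrs)
  then show ?thesis
  proof cases
    case 1
    show ?thesis by (rule that[of q r s]) (use mem dist in \<open>auto simp: pqrs 1 tuples4_def\<close>)
  next
    case 2
    show ?thesis by (rule that[of p s r]) (use mem dist swaps in \<open>auto simp: pqrs 2 tuples4_def\<close>)
  next
    case 3
    show ?thesis by (rule that[of s p q]) (use mem dist swaps in \<open>auto simp: pqrs 3 tuples4_def\<close>)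
  next
    case 4
    show ?thesis by (rule that[of q r p]) (use mem dist swaps in \<open>auto simp: pqrs 4 tuples4_def\<close>)
  qed
qed

definition theta :: real where "theta = integral\<^sup>L P phi"

lemma sample_1_4: "sample {1..4} = sample ({1} \<union> {2, 3, 4})"
proof -
  have "{1..4::nat} = {1} \<union> {2, 3, 4}" by auto
  then show ?thesis by simp
qed

text \<open>Tests the kernel against an event about the first observation, as the characterization
  of the conditional expectation demands. The value does not depend on the order of the indices in
  \<open>xs\<close>.\<close>

lemma integral_indicator_kern:
  assumes xs: "xs \<in> tuples4 4" and B [measurable]: "B \<in> sets P"
  shows "integrable (sample {1..4}) (\<lambda>x. indicator B (x 1) * K x xs)"
    and "integrable P (\<lambda>u. indicator B u * phi u)"
    and "(\<integral>x. indicator B (x 1) * K x xs \<partial>sample {1..4}) = (\<integral>u. indicator B u * phi u \<partial>P)"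
proof -
  have [measurable]: "(\<lambda>x. K x ys) \<in> borel_measurable (sample {1..4})" if "ys \<in> tuples4 4" for ys
    by (rule measurable_kern_tuples4[OF that permutes_id])
  show int: "integrable (sample {1..4}) (\<lambda>x. indicator B (x 1) * K x xs)"
  proof (rule Bochner_Integration.integrable_bound[OF integrable_kern[OF _ xs permutes_id]])
    show "(\<lambda>x. indicator B (x 1) * K x xs) \<in> borel_measurable (sample {1..4})"
      using xs by measurable
  qed (auto intro!: AE_I2 simp: indicator_def)
  \<comment> \<open>Four distinct indices from \<open>{1..4}\<close> use up the whole set, so
    \<open>1\<close> occurs and can be moved to the front.\<close>
  have "set xs = {1..4}"
  proof -
    have "card (set xs) = 4" "set xs \<subseteq> {1..4}"
      using xs distinct_card[of xs] by (auto simp: tuples4_def)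
    then show ?thesis by (simp add: card_subset_eq)
  qed
  then have "1 \<in> set xs" by simp
  then obtain b c d where bcd: "[1, b, c, d] \<in> tuples4 4" "{1, b, c, d} = set xs"
    and eq: "\<forall>x\<in>space (sample {1..4}). K x xs = K x [1, b, c, d]"
    using kern_front[OF xs] by metis
  have dist: "distinct [b, c, d]" "{b, c, d} \<inter> {1} = {}" using bcd(1) by (auto simp: tuples4_def)
  have sp: "sample {1..4} = sample ({1} \<union> {b, c, d})"
  proof -
    have "{1..4} = {1} \<union> {b, c, d}" using bcd(2) \<open>set xs = {1..4}\<close> by auto
    then show ?thesis by (simp only:)
  qed
  let ?W = "\<lambda>x. indicator B (x 1) :: real"
  let ?f = "\<lambda>x. ?W (restrict x {1}) * h_in gY gZ (x 1) (x b) (x c) (x d)"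
  have W: "?W \<in> borel_measurable (sample {1})" by measurable
  have eq': "indicator B (x 1) * K x xs = ?f x" if "x \<in> space (sample {1..4})" for x
    using bspec[OF eq that] by (simp add: K_eq_h_in)
  have int': "integrable (sample ({1} \<union> {b, c, d})) ?f"
    unfolding sp[symmetric]
    by (rule Bochner_Integration.integrable_cong[THEN iffD1, OF refl eq' int])
  note fold = fold_phi[of "{1}" 1 b c d ?W, OF _ _ dist W int']
  show "integrable P (\<lambda>u. indicator B u * phi u)"
    using fold(1) integrable_integral_component(1)[of 1 "{1}" "\<lambda>u. indicator B u * phi u"] by simp
  have "(\<integral>x. indicator B (x 1) * K x xs \<partial>sample {1..4}) = integral\<^sup>L (sample {1..4}) ?f"
    by (rule Bochner_Integration.integral_cong[OF refl eq'])
  also have "\<dots> = (\<integral>x. indicator B (x 1) * phi (x 1) \<partial>sample {1})"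
    unfolding sp using fold(2) by simp
  also have "\<dots> = (\<integral>u. indicator B u * phi u \<partial>P)"
    by (rule integrable_integral_component(2)) auto
  finally show "(\<integral>x. indicator B (x 1) * K x xs \<partial>sample {1..4}) = (\<integral>u. indicator B u * phi u \<partial>P)" .
qed

lemma tuples4_1234: "[1, 2, 3, 4] \<in> tuples4 4"
  by (auto simp: tuples4_def)

lemma integrable_phi: "integrable P phi"
proof -
  have "integrable P (\<lambda>u. indicator (space P) u * phi u)"
    by (rule integral_indicator_kern(2)[OF tuples4_1234]) simp
  then show ?thesis
    by (rule Bochner_Integration.integrable_cong[THEN iffD1, rotated -1]) auto
qed

lemma integral_kern:
  assumes xs: "xs \<in> tuples4 n"
  shows "(\<integral>x. K x xs \<partial>sample {1..n}) = theta"
proof -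
  let ?F = "\<lambda>x. K x [0, 1, 2, 3]"
  have F: "?F \<in> borel_measurable (sample {..<4})"
    by (rule measurable_kern) (auto dest!: less4_cases)
  have *: "(\<integral>x. K x xs \<partial>sample {1..n}) = integral\<^sup>L (sample {..<4}) ?F"
    if "xs \<in> tuples4 n" for xs n
  proof -
    have len: "length xs = 4" and "distinct xs" "set xs \<subseteq> {1..n}"
      using that by (auto simp: tuples4_def)
    then show ?thesis
      using integral_sample_nth[of xs "{1..n}" ?F] F unfolding len by (simp add: kern_def)
  qed
  have "(\<integral>x. K x xs \<partial>sample {1..n}) = (\<integral>x. K x [1, 2, 3, 4] \<partial>sample {1..4})"
    using *[OF xs] *[OF tuples4_1234] by simp
  also have "\<dots> = (\<integral>x. indicator (space P) (x 1) * K x [1, 2, 3, 4] \<partial>sample {1..4})"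
    by (rule Bochner_Integration.integral_cong[OF refl]) (simp add: sample_in_space)
  also have "\<dots> = (\<integral>u. indicator (space P) u * phi u \<partial>P)"
    by (rule integral_indicator_kern(3)[OF tuples4_1234]) simp
  also have "\<dots> = theta"
    unfolding theta_def by (rule Bochner_Integration.integral_cong[OF refl]) simp
  finally show ?thesis .
qed

section \<open>Expectations of products of two kernels\<close>

lemma restrict_K: "{a, b, c, d} \<subseteq> I \<Longrightarrow> K (restrict x I) [a, b, c, d] = K x [a, b, c, d]"
  by (simp add: kern_def)

text \<open>Folding 5, 6, 7 and then 2, 3, 4 produces \<open>phi\<close> at the shared observation
  twice. Square integrability of \<open>phi\<close> is the integrability part of the second
  fold.\<close>

lemma integrable_phi_sq: "integrable P (\<lambda>u. (phi u)\<^sup>2)"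
  and integral_kern_share1_aux:
    "(\<integral>x. K x [1, 2, 3, 4] * K x [1, 5, 6, 7] \<partial>sample {1..7}) = (\<integral>u. (phi u)\<^sup>2 \<partial>P)"
proof -
  let ?f = "\<lambda>x. K (restrict x {1..4}) [1, 2, 3, 4] * h_in gY gZ (x 1) (x 5) (x 6) (x 7)"
  have sp: "{1..7} = {1..4} \<union> {5, 6, 7::nat}" by auto
  have f: "K x [1, 2, 3, 4] * K x [1, 5, 6, 7] = ?f x" for x
    by (simp add: restrict_K) (simp add: K_eq_h_in)
  have t7: "[1, 2, 3, 4] \<in> tuples4 7" "[1, 5, 6, 7] \<in> tuples4 7"
    by (auto simp: tuples4_def)
  have int: "integrable (sample ({1..4} \<union> {5, 6, 7})) ?f"
    using integrable_kern_mult(1)[OF _ t7 permutes_id] unfolding f sp by simp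
  have K4: "(\<lambda>x. K x [1, 2, 3, 4]) \<in> borel_measurable (sample {1..4})"
    by (rule measurable_kern_tuples4[OF tuples4_1234 permutes_id])
  note 1 = fold_phi[of "{1..4}" 1 5 6 7 "\<lambda>x. K x [1, 2, 3, 4]", OF _ _ _ _ K4 int]
  let ?g = "\<lambda>x. phi (restrict x {1} 1) * h_in gY gZ (x 1) (x 2) (x 3) (x 4)"
  have g: "K x [1, 2, 3, 4] * phi (x 1) = ?g x" for x
    by (simp add: K_eq_h_in)
  have int': "integrable (sample ({1} \<union> {2, 3, 4})) ?g"
    using 1(1) unfolding g sample_1_4 by simp
  have W: "(\<lambda>x. phi (x 1)) \<in> borel_measurable (sample {1})" by measurable
  note 2 = fold_phi[of "{1}" 1 2 3 4 "\<lambda>x. phi (x 1)", OF _ _ _ _ W int']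
  have sq: "(\<lambda>u. (phi u)\<^sup>2) \<in> borel_measurable P" by measurable
  show "integrable P (\<lambda>u. (phi u)\<^sup>2)"
    using 2(1) integrable_integral_component(1)[of 1 "{1}", OF _ sq] by (simp add: power2_eq_square)
  have "(\<integral>x. K x [1, 2, 3, 4] * K x [1, 5, 6, 7] \<partial>sample {1..7})
      = (\<integral>x. K x [1, 2, 3, 4] * phi (x 1) \<partial>sample {1..4})"
    unfolding f sp using 1(2) by simp
  also have "\<dots> = (\<integral>x. phi (x 1) * phi (x 1) \<partial>sample {1})"
    unfolding g sample_1_4 using 2(2) by simp
  also have "\<dots> = (\<integral>u. (phi u)\<^sup>2 \<partial>P)"
    using integrable_integral_component(2)[of 1 "{1}", OF _ sq] by (simp add: power2_eq_square)
  finally show "(\<integral>x. K x [1, 2, 3, 4] * K x [1, 5, 6, 7] \<partial>sample {1..7}) = (\<integral>u. (phi u)\<^sup>2 \<partial>P)" .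
qed

lemma integral_kern_disjoint_aux:
  "(\<integral>x. K x [1, 2, 3, 4] * K x [5, 6, 7, 8] \<partial>sample {1..8}) = theta\<^sup>2"
proof -
  interpret PP: product_prob_space "\<lambda>_::nat. P" UNIV by (rule product_prob_space_P)
  \<comment> \<open>The block keeps 5, the front index of the second kernel, as
    \<open>fold_phi\<close> integrates out only the other three. After the second fold only the
    independent observations 1 and 5 remain.\<close>
  let ?I = "{1, 2, 3, 4, 5::nat}"
  let ?f = "\<lambda>x. K (restrict x ?I) [1, 2, 3, 4] * h_in gY gZ (x 5) (x 6) (x 7) (x 8)"
  have sp: "{1..8} = ?I \<union> {6, 7, 8::nat}" by auto
  have f: "K x [1, 2, 3, 4] * K x [5, 6, 7, 8] = ?f x" for x
    by (simp add: restrict_K) (simp add: K_eq_h_in)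
  have t8: "[1, 2, 3, 4] \<in> tuples4 8" "[5, 6, 7, 8] \<in> tuples4 8"
    by (auto simp: tuples4_def)
  have int: "integrable (sample (?I \<union> {6, 7, 8})) ?f"
    using integrable_kern_mult(1)[OF _ t8 permutes_id] unfolding f sp by simp
  have K4: "(\<lambda>x. K x [1, 2, 3, 4]) \<in> borel_measurable (sample ?I)"
    by (rule measurable_kern) (auto dest!: less4_cases)
  note 1 = fold_phi[of ?I 5 6 7 8 "\<lambda>x. K x [1, 2, 3, 4]", OF _ _ _ _ K4 int]
  let ?g = "\<lambda>x. phi (restrict x {1, 5} 5) * h_in gY gZ (x 1) (x 2) (x 3) (x 4)"
  have g: "K x [1, 2, 3, 4] * phi (x 5) = ?g x" for x
    by (simp add: K_eq_h_in)
  have sp': "?I = {1, 5} \<union> {2, 3, 4}" by auto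
  have int': "integrable (sample ({1, 5} \<union> {2, 3, 4})) ?g"
    using 1(1) unfolding g sp' by simp
  have W: "(\<lambda>x. phi (x 5)) \<in> borel_measurable (sample {1, 5})" by measurable
  note 2 = fold_phi[of "{1, 5}" 1 2 3 4 "\<lambda>x. phi (x 5)", OF _ _ _ _ W int']
  have "(\<integral>x. K x [1, 2, 3, 4] * K x [5, 6, 7, 8] \<partial>sample {1..8})
      = (\<integral>x. K x [1, 2, 3, 4] * phi (x 5) \<partial>sample ?I)"
    unfolding f sp using 1(2) by simp
  also have "\<dots> = (\<integral>x. phi (x 5) * phi (x 1) \<partial>sample {1, 5})"
    unfolding g sp' using 2(2) by simp
  also have "\<dots> = (\<integral>x. (\<Prod>i\<in>{1, 5}. phi (x i)) \<partial>sample {1, 5})"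
    by (simp add: mult.commute)
  also have "\<dots> = (\<Prod>i\<in>{1, 5::nat}. theta)"
    unfolding theta_def by (rule PP.product_integral_prod) (auto intro: integrable_phi)
  finally show ?thesis by (simp add: power2_eq_square)
qed

lemma integral_kern_disjoint:
  assumes xs: "xs \<in> tuples4 n" and ys: "ys \<in> tuples4 n" and disj: "set xs \<inter> set ys = {}"
  shows "(\<integral>x. K x xs * K x ys \<partial>sample {1..n}) = theta\<^sup>2"
proof -
  let ?F = "\<lambda>x. K x [0, 1, 2, 3] * K x [4, 5, 6, 7]"
  have F: "?F \<in> borel_measurable (sample {..<8})"
    by (intro borel_measurable_times measurable_kern) (auto dest!: less4_cases)
  obtain a b c d where xs4: "xs = [a, b, c, d]"
    using length4_nth[of xs] xs by (auto simp: tuples4_def)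
  obtain p q r s where ys4: "ys = [p, q, r, s]"
    using length4_nth[of ys] ys by (auto simp: tuples4_def)
  have "(\<integral>x. K x xs * K x ys \<partial>sample {1..n}) = integral\<^sup>L (sample {..<8}) ?F"
  proof -
    have len: "length [a, b, c, d, p, q, r, s] = 8" by simp
    have "distinct [a, b, c, d, p, q, r, s]" "set [a, b, c, d, p, q, r, s] \<subseteq> {1..n}"
      using xs ys disj by (auto simp: tuples4_def xs4 ys4)
    from integral_sample_nth[OF this, of ?F, unfolded len, OF F]
    show ?thesis by (simp add: kern_def xs4 ys4)
  qed
  also have "\<dots> = (\<integral>x. K x [1, 2, 3, 4] * K x [5, 6, 7, 8] \<partial>sample {1..8})"
  proof -
    have len: "length [1, 2, 3, 4, 5, 6, 7, 8 :: nat] = 8" by simp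
    have "distinct [1, 2, 3, 4, 5, 6, 7, 8 :: nat]" "set [1, 2, 3, 4, 5, 6, 7, 8] \<subseteq> {1..8::nat}"
      by auto
    from integral_sample_nth[OF this, of ?F, unfolded len, OF F]
    show ?thesis by (simp add: kern_def)
  qed
  finally show ?thesis by (simp add: integral_kern_disjoint_aux)
qed

text \<open>With the shared index at the front of both tuples, seven distinct indices remain in one
  standard pattern, whatever the original positions of the shared index.\<close>

lemma integral_kern_share1:
  assumes xs: "xs \<in> tuples4 n" and ys: "ys \<in> tuples4 n" and one: "card (set xs \<inter> set ys) = 1"
  shows "(\<integral>x. K x xs * K x ys \<partial>sample {1..n}) = (\<integral>u. (phi u)\<^sup>2 \<partial>P)"
proof -
  let ?F = "\<lambda>x. K x [0, 1, 2, 3] * K x [0, 4, 5, 6]"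
  have F: "?F \<in> borel_measurable (sample {..<7})"
    by (intro borel_measurable_times measurable_kern) (auto dest!: less4_cases)
  obtain u where u: "set xs \<inter> set ys = {u}"
    using one by (rule card_1_singletonE)
  obtain b c d where x4: "[u, b, c, d] \<in> tuples4 n" "{u, b, c, d} = set xs"
    "\<forall>x\<in>space (sample {1..n}). K x xs = K x [u, b, c, d]"
    using kern_front[OF xs, of u] u by blast
  obtain q r s where y4: "[u, q, r, s] \<in> tuples4 n" "{u, q, r, s} = set ys"
    "\<forall>x\<in>space (sample {1..n}). K x ys = K x [u, q, r, s]"
    using kern_front[OF ys, of u] u by blast
  have dist: "distinct [u, b, c, d, q, r, s]"
    using u x4(1,2) y4(1,2) by (auto simp: tuples4_def)
  have "(\<integral>x. K x xs * K x ys \<partial>sample {1..n}) = (\<integral>x. K x [u, b, c, d] * K x [u, q, r, s] \<partial>sample {1..n})"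
    by (rule Bochner_Integration.integral_cong[OF refl]) (simp add: x4(3) y4(3))
  also have "\<dots> = integral\<^sup>L (sample {..<7}) ?F"
  proof -
    have len: "length [u, b, c, d, q, r, s] = 7" by simp
    have "set [u, b, c, d, q, r, s] \<subseteq> {1..n}"
      using x4(1) y4(1) by (auto simp: tuples4_def)
    from integral_sample_nth[OF dist this, of ?F, unfolded len, OF F]
    show ?thesis by (simp add: kern_def)
  qed
  also have "\<dots> = (\<integral>x. K x [1, 2, 3, 4] * K x [1, 5, 6, 7] \<partial>sample {1..7})"
  proof -
    have len: "length [1, 2, 3, 4, 5, 6, 7 :: nat] = 7" by simp
    have "distinct [1, 2, 3, 4, 5, 6, 7 :: nat]" "set [1, 2, 3, 4, 5, 6, 7] \<subseteq> {1..7::nat}"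
      by auto
    from integral_sample_nth[OF this, of ?F, unfolded len, OF F]
    show ?thesis by (simp add: kern_def)
  qed
  finally show ?thesis by (simp add: integral_kern_share1_aux)
qed

lemma psi1_eq: "psi1 gY gZ P = (\<integral>u. (phi u)\<^sup>2 \<partial>P) - theta\<^sup>2"
proof -
  let ?S = "sample {1..4::nat}"
  let ?F = "vimage_algebra (space ?S) (\<lambda>x. x 1) P"
  let ?E = "real_cond_exp ?S ?F (h_in_sym gY gZ)"
  interpret S: prob_space ?S by (rule prob_space_sample)
  have X1: "(\<lambda>x. x 1) \<in> ?S \<rightarrow>\<^sub>M P" by measurable
  have X1_space: "(\<lambda>x. x 1) \<in> space ?S \<rightarrow> space P"
    using measurable_space[OF X1] by auto
  have setsF: "sets ?F = {(\<lambda>x. x 1) -` B \<inter> space ?S | B. B \<in> sets P}"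
    by (rule sets_vimage_algebra2[OF X1_space])
  have "subalgebra ?S ?F"
    unfolding subalgebra_def setsF using measurable_sets[OF X1] by auto
  then interpret F: finite_measure_subalgebra ?S ?F
    by (unfold_locales)
  have tuple: "[\<sigma> 1, \<sigma> 2, \<sigma> 3, \<sigma> 4] \<in> tuples4 4" if "\<sigma> permutes {1..4}" for \<sigma>
  proof -
    have "\<sigma> i \<in> {1..4}" if "i \<in> {1..4}" for i
      using \<open>\<sigma> permutes {1..4}\<close> that by (simp only: permutes_in_image)
    then have "set [\<sigma> 1, \<sigma> 2, \<sigma> 3, \<sigma> 4] \<subseteq> {1..4}" by simp
    moreover have "distinct [\<sigma> 1, \<sigma> 2, \<sigma> 3, \<sigma> 4]"
      using permutes_inj[OF that] by (simp add: inj_eq)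
    ultimately show ?thesis by (simp add: tuples4_def)
  qed
  have fact4: "fact 4 = (24 :: real)" by (simp add: fact_numeral)
  have sym: "h_in_sym gY gZ x = (\<Sum>\<sigma> | \<sigma> permutes {1..4}. K x [\<sigma> 1, \<sigma> 2, \<sigma> 3, \<sigma> 4]) / 24" for x
    by (simp add: h_in_sym_def K_eq_h_in fact4)
  have int_sym: "integrable ?S (h_in_sym gY gZ)"
    unfolding sym[abs_def]
    by (intro Bochner_Integration.integrable_divide Bochner_Integration.integrable_sum
        integrable_kern permutes_id tuple) simp_all
  have int_phi: "integrable ?S (\<lambda>x. phi (x 1))"
    using integrable_integral_component(1)[of 1 "{1..4}" phi] integrable_phi by simp
  \<comment> \<open>Sets of \<open>?F\<close> are events about the first coordinate. On each of them
    all 24 summands of the symmetrized kernel have the same integral, so their average is that of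
    \<open>phi\<close>.\<close>
  have charact: "(\<integral>x\<in>A. h_in_sym gY gZ x \<partial>?S) = (\<integral>x\<in>A. phi (x 1) \<partial>?S)" if A: "A \<in> sets ?F" for A
  proof -
    obtain B where B [measurable]: "B \<in> sets P" and A_eq: "A = (\<lambda>x. x 1) -` B \<inter> space ?S"
      using A unfolding setsF by auto
    have ind: "indicator A x = (indicator B (x 1) :: real)" if "x \<in> space ?S" for x
      using that by (simp add: A_eq indicator_def)
    have "(\<integral>x\<in>A. h_in_sym gY gZ x \<partial>?S)
        = (\<integral>x. (\<Sum>\<sigma> | \<sigma> permutes {1..4}. indicator B (x 1) * K x [\<sigma> 1, \<sigma> 2, \<sigma> 3, \<sigma> 4]) / 24 \<partial>?S)"
      unfolding set_lebesgue_integral_def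
      by (rule Bochner_Integration.integral_cong[OF refl]) (simp add: ind sym sum_distrib_left)
    also have "\<dots> = (\<Sum>\<sigma> | \<sigma> permutes {1..4::nat}. \<integral>u. indicator B u * phi u \<partial>P) / 24"
    proof -
      have "(\<integral>x. (\<Sum>\<sigma> | \<sigma> permutes {1..4}. indicator B (x 1) * K x [\<sigma> 1, \<sigma> 2, \<sigma> 3, \<sigma> 4]) \<partial>?S)
          = (\<Sum>\<sigma> | \<sigma> permutes {1..4}. \<integral>x. indicator B (x 1) * K x [\<sigma> 1, \<sigma> 2, \<sigma> 3, \<sigma> 4] \<partial>?S)"
        by (rule Bochner_Integration.integral_sum)
           (rule integral_indicator_kern(1)[OF tuple B], simp)
      also have "\<dots> = (\<Sum>\<sigma> | \<sigma> permutes {1..4::nat}. \<integral>u. indicator B u * phi u \<partial>P)"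
        by (rule sum.cong[OF refl], rule integral_indicator_kern(3)[OF tuple B]) simp
      finally show ?thesis by (simp only: Bochner_Integration.integral_divide_zero)
    qed
    also have "\<dots> = (\<integral>u. indicator B u * phi u \<partial>P)"
      by (simp add: card_permutations[of "{1..4::nat}" 4] fact4)
    also have "\<dots> = (\<integral>x. indicator B (x 1) * phi (x 1) \<partial>?S)"
      by (rule integrable_integral_component(2)[symmetric]) auto
    also have "\<dots> = (\<integral>x\<in>A. phi (x 1) \<partial>?S)"
      unfolding set_lebesgue_integral_def
      by (rule Bochner_Integration.integral_cong[OF refl]) (simp add: ind)
    finally show ?thesis .
  qed
  have phi_F: "(\<lambda>x. phi (x 1)) \<in> borel_measurable ?F"
    by (rule measurable_compose[OF measurable_vimage_algebra1[OF X1_space] measurable_phi])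
  have AE: "AE x in ?S. ?E x = phi (x 1)"
    by (rule F.real_cond_exp_charact[OF charact int_sym int_phi phi_F])
  have E_meas [measurable]: "?E \<in> borel_measurable ?S" by (rule borel_measurable_cond_exp2)
  have sq: "(\<lambda>u. (phi u)\<^sup>2) \<in> borel_measurable P" by measurable
  have mean: "integral\<^sup>L ?S ?E = (\<integral>x. phi (x 1) \<partial>?S)"
    by (rule integral_cong_AE[OF _ _ AE]) measurable
  have "psi1 gY gZ P = S.variance ?E"
    by (simp add: psi1_def iid_def)
  also have "\<dots> = S.variance (\<lambda>x. phi (x 1))"
    unfolding mean by (rule integral_cong_AE) (measurable, use AE in auto)
  also have "\<dots> = (\<integral>x. (phi (x 1))\<^sup>2 \<partial>?S) - (\<integral>x. phi (x 1) \<partial>?S)\<^sup>2"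
    using integrable_integral_component(1)[of 1 "{1..4}", OF _ sq] integrable_phi_sq
    by (intro S.variance_eq int_phi) simp
  also have "\<dots> = (\<integral>u. (phi u)\<^sup>2 \<partial>P) - theta\<^sup>2"
    using integrable_integral_component(2)[of 1 "{1..4}", OF _ sq]
      integrable_integral_component(2)[of 1 "{1..4}" phi] by (simp add: theta_def)
  finally show ?thesis .
qed

section \<open>The variance of the test statistic\<close>

lemma nonempty_tuples4: "4 \<le> n \<Longrightarrow> tuples4 n \<noteq> {}"
  using pos_card_tuples4[of n] by auto

lemma integrable_U_stat:
  assumes "4 \<le> n"
  shows "integrable (sample {1..n}) (U_stat gY gZ n)"
    and "integrable (sample {1..n}) (\<lambda>x. (U_stat gY gZ n x)\<^sup>2)"
proof -
  show "integrable (sample {1..n}) (U_stat gY gZ n)"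
    unfolding U_stat_eq_U_perm U_perm_eq[OF assms, abs_def]
    by (intro Bochner_Integration.integrable_divide Bochner_Integration.integrable_sum
        integrable_kern assms permutes_id)
  show "integrable (sample {1..n}) (\<lambda>x. (U_stat gY gZ n x)\<^sup>2)"
    unfolding U_stat_eq_U_perm by (rule integrable_U_perm_sq[OF assms permutes_id])
qed

lemma integral_U_stat:
  assumes "4 \<le> n"
  shows "(\<integral>x. U_stat gY gZ n x \<partial>sample {1..n}) = theta"
proof -
  have "(\<integral>x. U_stat gY gZ n x \<partial>sample {1..n})
      = (\<Sum>xs\<in>tuples4 n. \<integral>x. K x xs \<partial>sample {1..n}) / card (tuples4 n)"
    unfolding U_stat_eq_U_perm U_perm_eq[OF assms, abs_def] Bochner_Integration.integral_divide_zero
    by (subst Bochner_Integration.integral_sum) (use integrable_kern[OF assms _ permutes_id] in auto)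
  also have "\<dots> = theta"
    using nonempty_tuples4[OF assms] by (simp add: integral_kern)
  finally show ?thesis .
qed

lemma psi1_nonneg: "0 \<le> psi1 gY gZ P"
proof -
  have "0 \<le> variance phi" by simp
  then show ?thesis
    using variance_eq[OF integrable_phi integrable_phi_sq] by (simp add: psi1_eq theta_def)
qed

lemma variance_U_stat_le:
  assumes n: "4 \<le> n"
  shows "(\<integral>x. (U_stat gY gZ n x - theta)\<^sup>2 \<partial>sample {1..n})
    \<le> 171 * psi1 gY gZ P / real n + 700000 * second_moment / (real n)\<^sup>2"
proof -
  let ?S = "sample {1..n}" and ?N = "real (card (tuples4 n))" and ?\<psi> = "psi1 gY gZ P"
  let ?c = "\<lambda>xs ys. card (set xs \<inter> set ys)"
  interpret S: prob_space ?S by (rule prob_space_sample)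
  note N = pos_card_tuples4[OF n]
  \<comment> \<open>Since \<open>psi1\<close> is nonnegative it may be charged to larger overlaps
    too, so that the counts for overlap at least one and at least two suffice.\<close>
  have cov: "(\<integral>x. K x xs * K x ys \<partial>?S) - theta\<^sup>2
      \<le> of_bool (1 \<le> ?c xs ys) * ?\<psi> + of_bool (2 \<le> ?c xs ys) * (256 * second_moment)"
    if "xs \<in> tuples4 n" "ys \<in> tuples4 n" for xs ys
  proof -
    consider "?c xs ys = 0" | "?c xs ys = 1" | "2 \<le> ?c xs ys" by linarith
    then show ?thesis
    proof cases
      case 1
      then show ?thesis using integral_kern_disjoint[OF that] by simp
    next
      case 2
      then show ?thesis using integral_kern_share1[OF that] by (simp add: psi1_eq)
    next
      case 3
      have "(\<integral>x. K x xs * K x ys \<partial>?S) \<le> 256 * second_moment"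
        by (rule integrable_kern_mult(2)[OF n that permutes_id])
      moreover have "0 \<le> theta\<^sup>2" by simp
      ultimately have "(\<integral>x. K x xs * K x ys \<partial>?S) - theta\<^sup>2 \<le> ?\<psi> + 256 * second_moment"
        using psi1_nonneg by linarith
      then show ?thesis using 3 by simp
    qed
  qed
  have row: "(\<Sum>ys\<in>tuples4 n. (\<integral>x. K x xs * K x ys \<partial>?S) - theta\<^sup>2)
      \<le> 16 * real n ^ 3 * ?\<psi> + 256 * (real n)\<^sup>2 * (256 * second_moment)"
    if xs: "xs \<in> tuples4 n" for xs
  proof -
    have len: "length xs = 4" using xs by (simp add: tuples4_def)
    have count: "(\<Sum>ys\<in>tuples4 n. of_bool (k \<le> ?c xs ys)) = real (card {ys \<in> tuples4 n. k \<le> ?c xs ys})"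
      for k
      by (simp add: of_bool_def sum.If_cases Int_def)
    have "real (card {ys \<in> tuples4 n. 1 \<le> ?c xs ys}) \<le> real (16 * n ^ 3)"
      using card_overlap_ge1[OF len] by (simp only: of_nat_le_iff)
    then have 1: "real (card {ys \<in> tuples4 n. 1 \<le> ?c xs ys}) \<le> 16 * real n ^ 3" by simp
    have "real (card {ys \<in> tuples4 n. 2 \<le> ?c xs ys}) \<le> real (256 * n ^ 2)"
      using card_overlap_ge2[OF len] by (simp only: of_nat_le_iff)
    then have 2: "real (card {ys \<in> tuples4 n. 2 \<le> ?c xs ys}) \<le> 256 * (real n)\<^sup>2" by simp
    have "(\<Sum>ys\<in>tuples4 n. (\<integral>x. K x xs * K x ys \<partial>?S) - theta\<^sup>2)
        \<le> (\<Sum>ys\<in>tuples4 n. of_bool (1 \<le> ?c xs ys) * ?\<psi> + of_bool (2 \<le> ?c xs ys) * (256 * second_moment))"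
      by (intro sum_mono cov xs)
    also have "\<dots> = real (card {ys \<in> tuples4 n. 1 \<le> ?c xs ys}) * ?\<psi>
        + real (card {ys \<in> tuples4 n. 2 \<le> ?c xs ys}) * (256 * second_moment)"
      unfolding sum.distrib sum_distrib_right[symmetric] count ..
    also have "\<dots> \<le> 16 * real n ^ 3 * ?\<psi> + 256 * (real n)\<^sup>2 * (256 * second_moment)"
      using 1 2 psi1_nonneg second_moment_nonneg by (intro add_mono mult_right_mono) auto
    finally show ?thesis .
  qed
  have "(\<integral>x. (U_stat gY gZ n x - theta)\<^sup>2 \<partial>?S) = (\<integral>x. (U_stat gY gZ n x)\<^sup>2 \<partial>?S) - theta\<^sup>2"
    using S.variance_eq[OF integrable_U_stat[OF n]] by (simp add: integral_U_stat[OF n])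
  also have "(\<integral>x. (U_stat gY gZ n x)\<^sup>2 \<partial>?S)
      = (\<Sum>xs\<in>tuples4 n. \<Sum>ys\<in>tuples4 n. \<integral>x. K x xs * K x ys \<partial>?S) / ?N\<^sup>2"
  proof -
    note int = integrable_kern_mult(1)[OF n _ _ permutes_id]
    have "(\<integral>x. (\<Sum>xs\<in>tuples4 n. \<Sum>ys\<in>tuples4 n. K x xs * K x ys) \<partial>?S)
        = (\<Sum>xs\<in>tuples4 n. \<integral>x. (\<Sum>ys\<in>tuples4 n. K x xs * K x ys) \<partial>?S)"
      by (intro Bochner_Integration.integral_sum Bochner_Integration.integrable_sum int)
    also have "\<dots> = (\<Sum>xs\<in>tuples4 n. \<Sum>ys\<in>tuples4 n. \<integral>x. K x xs * K x ys \<partial>?S)"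
      by (intro sum.cong[OF refl] Bochner_Integration.integral_sum int)
    finally show ?thesis
      unfolding U_stat_eq_U_perm U_perm_sq[OF n] by simp
  qed
  also have "\<dots> - theta\<^sup>2
      = (\<Sum>xs\<in>tuples4 n. \<Sum>ys\<in>tuples4 n. (\<integral>x. K x xs * K x ys \<partial>?S) - theta\<^sup>2) / ?N\<^sup>2"
    using nonempty_tuples4[OF n]
    by (simp add: sum_subtractf diff_divide_distrib power2_eq_square)
  also have "\<dots> \<le> (\<Sum>xs\<in>tuples4 n. 16 * real n ^ 3 * ?\<psi> + 256 * (real n)\<^sup>2 * (256 * second_moment)) / ?N\<^sup>2"
    by (intro divide_right_mono sum_mono row) auto
  also have "\<dots> = (16 * real n ^ 3 * ?\<psi> + 256 * (real n)\<^sup>2 * (256 * second_moment)) / ?N"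
    using N by (simp add: power2_eq_square)
  also have "\<dots> \<le> (16 * real n ^ 3 * ?\<psi> + 256 * (real n)\<^sup>2 * (256 * second_moment)) / (3 / 32 * real n ^ 4)"
    using card_tuples4_ge[OF n] N n psi1_nonneg second_moment_nonneg
    by (intro divide_left_mono mult_pos_pos add_nonneg_nonneg) auto
  \<comment> \<open>512 / 3 is 16 * 32 / 3, from the overlap count and the lower bound 3/32; it is
    rounded up to 171.\<close>
  also have "\<dots> = 512 / 3 * (?\<psi> / real n) + 65536 * 32 / 3 * (second_moment / (real n)\<^sup>2)"
    using n by (simp add: field_simps power4_eq_xxxx power3_eq_cube power2_eq_square)
  also have "\<dots> \<le> 171 * (?\<psi> / real n) + 700000 * (second_moment / (real n)\<^sup>2)"
    using psi1_nonneg second_moment_nonneg by (intro add_mono mult_right_mono) auto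
  finally show ?thesis by simp
qed

section \<open>The power of the test\<close>

text \<open>Markov's inequality under the permutation distribution: at most a fraction \<alpha> of
  the permuted statistics exceeds \<open>t\<close>, so \<open>t\<close> belongs to the set whose
  infimum is the critical value.\<close>

lemma perm_crit_le:
  assumes \<alpha>: "0 < \<alpha>" "\<alpha> < 1" and t: "0 < t" and V: "perm_moment n x \<le> \<alpha> * t\<^sup>2"
  shows "perm_crit gY gZ n \<alpha> x \<le> t"
proof -
  let ?Pm = "{\<pi>. \<pi> permutes {1..n}}" and ?U = "\<lambda>\<pi>. U_perm gY gZ n \<pi> x"
  let ?T = "{t. 1 / fact n * (\<Sum>\<pi>\<in>?Pm. of_bool (?U \<pi> \<le> t)) \<ge> 1 - \<alpha>}"
  have fin: "finite ?Pm" by (simp add: finite_permutations)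
  have card: "real (card ?Pm) = fact n"
    by (simp add: card_permutations[of "{1..n}" n])
  have "1 - of_bool (?U \<pi> \<le> t) \<le> (?U \<pi>)\<^sup>2 / t\<^sup>2" for \<pi>
  proof (cases "?U \<pi> \<le> t")
    case False
    then have "t\<^sup>2 \<le> (?U \<pi>)\<^sup>2" using t by (intro power_mono) auto
    then show ?thesis using False t by simp
  qed simp
  then have "(\<Sum>\<pi>\<in>?Pm. 1 - of_bool (?U \<pi> \<le> t)) \<le> (\<Sum>\<pi>\<in>?Pm. (?U \<pi>)\<^sup>2 / t\<^sup>2)"
    by (rule sum_mono)
  also have "\<dots> = (\<Sum>\<pi>\<in>?Pm. (?U \<pi>)\<^sup>2) / t\<^sup>2"
    by (rule sum_divide_distrib[symmetric])
  also have "\<dots> = fact n * perm_moment n x / t\<^sup>2"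
    by (simp add: perm_moment_def)
  finally have "fact n - (\<Sum>\<pi>\<in>?Pm. of_bool (?U \<pi> \<le> t)) \<le> fact n * perm_moment n x / t\<^sup>2"
    by (simp only: sum_subtractf sum_constant card mult_1_right)
  also have "\<dots> \<le> fact n * (\<alpha> * t\<^sup>2) / t\<^sup>2"
    using V by (intro divide_right_mono mult_left_mono) auto
  also have "\<dots> = fact n * \<alpha>" using t by simp
  finally have "t \<in> ?T" by (simp add: field_simps)
  \<comment> \<open>The infimum of a real set lies below its members only if the set is bounded
    below. As 1 - \<alpha> > 0, each member of \<open>?T\<close> dominates some permuted statistic,
    hence their minimum.\<close>
  moreover have "bdd_below ?T"
  proof (rule bdd_belowI)
    fix s assume "s \<in> ?T"
    then have s: "1 - \<alpha> \<le> 1 / fact n * (\<Sum>\<pi>\<in>?Pm. of_bool (?U \<pi> \<le> s))" by simp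
    have "\<exists>\<pi>\<in>?Pm. ?U \<pi> \<le> s"
    proof (rule ccontr)
      assume "\<not> (\<exists>\<pi>\<in>?Pm. ?U \<pi> \<le> s)"
      then have "(\<Sum>\<pi>\<in>?Pm. of_bool (?U \<pi> \<le> s)) = (0 :: real)"
        by (intro sum.neutral) auto
      then have "1 - \<alpha> \<le> 0" using s by (simp only: mult_zero_right)
      then show False using \<alpha> by simp
    qed
    then obtain \<pi> where \<pi>: "\<pi> \<in> ?Pm" "?U \<pi> \<le> s" by blast
    have "Min (?U ` ?Pm) \<le> ?U \<pi>" using fin \<pi> by (intro Min_le) auto
    then show "Min (?U ` ?Pm) \<le> s" using \<pi> by simp
  qed
  ultimately show ?thesis
    unfolding perm_crit_def by (rule cInf_lower)
qed

lemma type_II_error_le: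
  assumes n: "4 \<le> n" and \<alpha>: "0 < \<alpha>" "\<alpha> < 1" and \<beta>: "0 < \<beta>"
    and pos: "0 < psi2 gY gZ P"
    and gap: "4096 * sqrt (max (psi1 gY gZ P / (\<beta> * real n))
      (enn2real (psi2 gY gZ P) / (\<alpha> * \<beta> * (real n)\<^sup>2))) \<le> (\<integral>x. U_stat gY gZ n x \<partial>sample {1..n})"
  shows "emeasure (sample {1..n}) {x \<in> space (sample {1..n}). U_stat gY gZ n x \<le> perm_crit gY gZ n \<alpha> x}
    \<le> ennreal \<beta>"
proof -
  let ?S = "sample {1..n}" and ?\<psi> = "psi1 gY gZ P" and ?U = "U_stat gY gZ n"
  define a where "a = ?\<psi> / (\<beta> * real n)"
  define b where "b = second_moment / (\<alpha> * \<beta> * (real n)\<^sup>2)"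
  interpret S: prob_space ?S by (rule prob_space_sample)
  have n0: "0 < real n" using n by simp
  \<comment> \<open>This makes \<open>b\<close> and with it \<open>theta\<close> positive, so that
    \<open>theta / 2\<close> is a legitimate threshold for both tail bounds.\<close>
  have "0 < second_moment"
    using pos psi2_eq by (simp add: second_moment_nonneg)
  then have b: "0 < b" using \<alpha> \<beta> n0 by (simp add: b_def)
  have a: "0 \<le> a" using psi1_nonneg \<beta> n0 by (simp add: a_def)
  have gap': "4096 * sqrt (max a b) \<le> theta"
    using gap by (simp add: integral_U_stat[OF n] a_def b_def second_moment_def)
  have "0 < 4096 * sqrt (max a b)" using b by simp
  then have theta: "0 < theta" using gap' by linarith
  have "(4096 * sqrt (max a b))\<^sup>2 \<le> theta\<^sup>2"
    using gap' b by (intro power_mono) auto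
  then have theta_sq: "16777216 * max a b \<le> theta\<^sup>2"
    using b by (simp add: power_mult_distrib)
  define A where "A = {x \<in> space ?S. theta / 2 \<le> \<bar>?U x - theta\<bar>}"
  define B where "B = {x \<in> space ?S. \<alpha> * (theta / 2)\<^sup>2 \<le> perm_moment n x}"
  have U_meas: "?U \<in> borel_measurable ?S"
    using integrable_U_stat(1)[OF n] by (rule borel_measurable_integrable)
  have V_meas: "perm_moment n \<in> borel_measurable ?S"
    using integrable_perm_moment[OF n] by (rule borel_measurable_integrable)
  have sets: "A \<in> sets ?S" "B \<in> sets ?S"
    unfolding A_def B_def using U_meas V_meas by measurable
  \<comment> \<open>Outside \<open>B\<close> the critical value is at most \<open>theta / 2\<close>,
    so a failure to reject puts U at least \<open>theta / 2\<close> below its mean.\<close>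
  have sub: "{x \<in> space ?S. ?U x \<le> perm_crit gY gZ n \<alpha> x} \<subseteq> A \<union> B"
  proof safe
    fix x assume x: "x \<in> space ?S" "?U x \<le> perm_crit gY gZ n \<alpha> x" "x \<notin> B"
    then have "perm_moment n x \<le> \<alpha> * (theta / 2)\<^sup>2" by (simp add: B_def)
    then have "perm_crit gY gZ n \<alpha> x \<le> theta / 2"
      using \<alpha> theta by (intro perm_crit_le) auto
    then have "theta / 2 \<le> \<bar>?U x - theta\<bar>" using x(2) by linarith
    then show "x \<in> A" using x(1) by (simp add: A_def)
  qed
  have "S.prob A \<le> (\<integral>x. (?U x - theta)\<^sup>2 \<partial>?S) / (theta / 2)\<^sup>2"
    using S.Chebyshev_inequality[OF U_meas integrable_U_stat(2)[OF n], of "theta / 2"] theta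
    by (simp add: A_def integral_U_stat[OF n])
  also have "\<dots> \<le> (171 * ?\<psi> / real n + 700000 * second_moment / (real n)\<^sup>2) / (theta / 2)\<^sup>2"
    by (intro divide_right_mono variance_U_stat_le[OF n]) simp
  also have "171 * ?\<psi> / real n = 171 * \<beta> * a"
    using \<beta> n0 by (simp add: a_def)
  also have "700000 * second_moment / (real n)\<^sup>2 = 700000 * \<beta> * (\<alpha> * b)"
    using \<alpha> \<beta> n0 by (simp add: b_def)
  also have "(171 * \<beta> * a + 700000 * \<beta> * (\<alpha> * b)) / (theta / 2)\<^sup>2 \<le> (700171 * \<beta> * max a b) / (theta / 2)\<^sup>2"
  proof (rule divide_right_mono)
    \<comment> \<open>\<open>b\<close> contains 1/\<alpha> for the sake of the permutation moment;
      in the variance the surplus factor \<alpha> is bounded by 1.\<close>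
    have "\<alpha> * b \<le> 1 * max a b" using \<alpha> b by (intro mult_mono) auto
    then have "700000 * \<beta> * (\<alpha> * b) \<le> 700000 * \<beta> * max a b"
      using \<beta> by (intro mult_left_mono) auto
    moreover have "171 * \<beta> * a \<le> 171 * \<beta> * max a b"
      using \<beta> by (intro mult_left_mono) auto
    ultimately show "171 * \<beta> * a + 700000 * \<beta> * (\<alpha> * b) \<le> 700171 * \<beta> * max a b"
      by (simp add: algebra_simps)
  qed simp
  finally have PA: "S.prob A \<le> 2800684 * \<beta> * max a b / theta\<^sup>2"
    by (simp add: power_divide)
  \<comment> \<open>Here the \<alpha> of Markov's threshold is absorbed exactly by the 1/\<alpha> in
    \<open>b\<close>.\<close>
  have "S.prob B \<le> (\<integral>x. perm_moment n x \<partial>?S) / (\<alpha> * (theta / 2)\<^sup>2)"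
    unfolding B_def
    by (rule integral_Markov_inequality_measure[OF integrable_perm_moment[OF n] sets.empty_sets])
       (use \<alpha> theta in \<open>auto intro!: AE_I2 sum_nonneg divide_nonneg_nonneg simp: perm_moment_def\<close>)
  also have "\<dots> \<le> (700000 * second_moment / (real n)\<^sup>2) / (\<alpha> * (theta / 2)\<^sup>2)"
    using \<alpha> by (intro divide_right_mono integral_perm_moment_le[OF n]) simp
  also have "\<dots> = 2800000 * \<beta> * b / theta\<^sup>2"
    using \<alpha> \<beta> n0 by (simp add: b_def power_divide)
  also have "\<dots> \<le> 2800000 * \<beta> * max a b / theta\<^sup>2"
    using \<beta> by (intro divide_right_mono mult_left_mono) auto
  finally have PB: "S.prob B \<le> 2800000 * \<beta> * max a b / theta\<^sup>2" .
  have "S.prob A + S.prob B \<le> 5600684 * \<beta> * max a b / theta\<^sup>2"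
  proof -
    have "c * \<beta> * max a b / theta\<^sup>2 = c * (\<beta> * max a b / theta\<^sup>2)" for c by simp
    then show ?thesis using PA PB by linarith
  qed
  also have "\<dots> \<le> \<beta>"
  proof -
    \<comment> \<open>5600684 = 4 * 700171 + 4 * 700000, the factors 4 coming from the square of
      \<open>theta / 2\<close>; 16777216 is the square of 4096.\<close>
    have "5600684 * \<beta> * max a b \<le> \<beta> * (16777216 * max a b)"
      using \<beta> b by simp
    also have "\<dots> \<le> \<beta> * theta\<^sup>2"
      using theta_sq \<beta> by (intro mult_left_mono) auto
    finally show ?thesis
      using theta by (simp add: divide_le_eq)
  qed
  finally have AB: "S.prob A + S.prob B \<le> \<beta>" .
  \<comment> \<open>Monotonicity asks for measurability of the larger set
    \<open>A \<union> B\<close>, so the argument never examines the critical value as a function of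
    the data.\<close>
  have "emeasure ?S {x \<in> space ?S. ?U x \<le> perm_crit gY gZ n \<alpha> x} \<le> emeasure ?S (A \<union> B)"
    using sub sets by (intro emeasure_mono) auto
  also have "\<dots> = ennreal (S.prob (A \<union> B))"
    by (rule S.emeasure_eq_measure)
  also have "\<dots> \<le> ennreal \<beta>"
    using measure_Un_le[OF sets] AB by (intro ennreal_leI) linarith
  finally show ?thesis .
qed

end

theorem theorem5p1:
  "\<exists>C::real. C > 0 \<and>
    (\<forall>(n::nat) (\<alpha>::real) (\<beta>::real) (MY::'y measure) (MZ::'z measure)
       (gY::'y \<Rightarrow> 'y \<Rightarrow> real) (gZ::'z \<Rightarrow> 'z \<Rightarrow> real) (\<P>::('y \<times> 'z) measure set).
      n \<ge> 4 \<longrightarrow> \<alpha> \<in> {0<..<1} \<longrightarrow> \<beta> \<in> {0<..<1 - \<alpha>} \<longrightarrow>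
      case_prod gY \<in> borel_measurable (MY \<Otimes>\<^sub>M MY) \<longrightarrow>
      case_prod gZ \<in> borel_measurable (MZ \<Otimes>\<^sub>M MZ) \<longrightarrow>
      (\<forall>y1\<in>space MY. \<forall>y2\<in>space MY. gY y1 y2 = gY y2 y1) \<longrightarrow>
      (\<forall>z1\<in>space MZ. \<forall>z2\<in>space MZ. gZ z1 z2 = gZ z2 z1) \<longrightarrow>
      (\<forall>P\<in>\<P>. prob_space P \<and> sets P = sets (MY \<Otimes>\<^sub>M MZ)) \<longrightarrow>
      (\<forall>P\<in>\<P>. 0 < psi2 gY gZ P) \<longrightarrow>
      (\<forall>P\<in>\<P>. psi2 gY gZ P < \<infinity> \<and>
         prob_space.expectation (iid n P) (U_stat gY gZ n) \<ge>
           C * sqrt (max (psi1 gY gZ P / (\<beta> * real n))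
                         (enn2real (psi2 gY gZ P) / (\<alpha> * \<beta> * (real n)\<^sup>2)))) \<longrightarrow>
      (SUP P\<in>\<P>. emeasure (iid n P)
         {x \<in> space (iid n P). U_stat gY gZ n x \<le> perm_crit gY gZ n \<alpha> x}) \<le> ennreal \<beta>)"
proof (rule exI[of _ 4096], intro conjI allI impI)
  fix n :: nat and \<alpha> \<beta> :: real and MY :: "'y measure" and MZ :: "'z measure"
    and gY :: "'y \<Rightarrow> 'y \<Rightarrow> real" and gZ :: "'z \<Rightarrow> 'z \<Rightarrow> real" and \<P> :: "('y \<times> 'z) measure set"
  assume n: "4 \<le> n" and \<alpha>: "\<alpha> \<in> {0<..<1}" and \<beta>: "\<beta> \<in> {0<..<1 - \<alpha>}"
    and meas: "case_prod gY \<in> borel_measurable (MY \<Otimes>\<^sub>M MY)"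
      "case_prod gZ \<in> borel_measurable (MZ \<Otimes>\<^sub>M MZ)"
    and sym: "\<forall>y1\<in>space MY. \<forall>y2\<in>space MY. gY y1 y2 = gY y2 y1"
      "\<forall>z1\<in>space MZ. \<forall>z2\<in>space MZ. gZ z1 z2 = gZ z2 z1"
    and P: "\<forall>P\<in>\<P>. prob_space P \<and> sets P = sets (MY \<Otimes>\<^sub>M MZ)"
    and pos: "\<forall>P\<in>\<P>. 0 < psi2 gY gZ P"
    and gap: "\<forall>P\<in>\<P>. psi2 gY gZ P < \<infinity> \<and>
         prob_space.expectation (iid n P) (U_stat gY gZ n) \<ge>
           4096 * sqrt (max (psi1 gY gZ P / (\<beta> * real n))
                         (enn2real (psi2 gY gZ P) / (\<alpha> * \<beta> * (real n)\<^sup>2)))"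
  show "(SUP P\<in>\<P>. emeasure (iid n P)
         {x \<in> space (iid n P). U_stat gY gZ n x \<le> perm_crit gY gZ n \<alpha> x}) \<le> ennreal \<beta>"
  proof (rule SUP_least)
    fix P assume "P \<in> \<P>"
    then interpret indep_test P MY MZ gY gZ
      using P gap meas sym by (auto simp: indep_test_def indep_test_axioms_def)
    show "emeasure (iid n P) {x \<in> space (iid n P). U_stat gY gZ n x \<le> perm_crit gY gZ n \<alpha> x} \<le> ennreal \<beta>"
      using type_II_error_le[of n \<alpha> \<beta>] n \<alpha> \<beta> pos gap \<open>P \<in> \<P>\<close> by (auto simp: iid_def)
  qed
qed simp

end
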